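(* For any $n>4$ there are full conformal foliations of $\mathbb{R}^n$ by minimal submanifolds of codimension $2$ which do not arise from Kähler structures.
   Context: A foliation $\mathcal{F}$ of codimension 2 of $\mathbb{R}^n$ is conformal if it is locally given by the fibres of horizontally conformal submersions to surfaces. It is full if it is not the inverse image $(\pi_A)^{-1}(\mathcal{F}')$ of a foliation $\mathcal{F}'$ of $A=\pi_A(\mathbb{R}^n)$, for any orthogonal projection $\pi_A$ onto a proper linear subspace $A$ of $\mathbb{R}^n$. A Kähler structure on $\mathbb{R}^{2m}$ is a constant (parallel) orthogonal complex structure $J$ ($J$ orthogonal, $J^2=-I$); a map $\phi$ into $\mathbb{C}$ is holomorphic with respect to $J$ if $d\phi(JX)=\mathrm{i}\,d\phi(X)$ for all tangent vectors $X$. A map $\phi:U\to\mathbb{C}$ on an open set $U\subset\mathbb{R}^n$ arises from a Kähler structure if either $n$ is even and $\phi$ is holomorphic with respect to a Kähler structure on $\mathbb{R}^n$, or $n$ is odd and, $\pi:\mathbb{R}^{n+1}\to\mathbb{R}^n$ being orthogonal projection, there is a map of the form $\phi\circ\pi$ on an open subset of $\mathbb{R}^{n+1}$ (with image $U$ under $\pi$) which is holomorphic with respect to a Kähler structure on $\mathbb{R}^{n+1}$. A foliation of $\mathbb{R}^n$ arises from a Kähler structure if its leaves are the (connected components of) fibres of a map which arises from a Kähler structure. *)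

theory Defs
  imports "HOL-Analysis.Analysis" "HOL-Library.Disjoint_Sets"
begin

text \<open>\<open>Ck_on k f S\<close> is meant for open \<open>S\<close> in a finite-dimensional space, where it says that
  \<open>f\<close> is of class \<open>C\<^sup>k\<close> on \<open>S\<close>.\<close>

primrec Ck_on ::
  "nat \<Rightarrow> ('a::real_normed_vector \<Rightarrow> 'b::real_normed_vector) \<Rightarrow> 'a set \<Rightarrow> bool" where
  "Ck_on 0 f S \<longleftrightarrow> continuous_on S f"
| "Ck_on (Suc k) f S \<longleftrightarrow>
     (\<forall>x\<in>S. f differentiable (at x)) \<and>
     (\<forall>v. Ck_on k (\<lambda>x. frechet_derivative f (at x) v) S)"

definition smooth_on :: "'a::real_normed_vector set \<Rightarrow> ('a \<Rightarrow> 'b::real_normed_vector) \<Rightarrow> bool" where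
  "smooth_on S f \<longleftrightarrow> (\<forall>k. Ck_on k f S)"

definition orth_proj :: "'a::euclidean_space set \<Rightarrow> 'a \<Rightarrow> 'a" where
  "orth_proj A x = (THE y. y \<in> A \<and> (\<forall>a\<in>A. orthogonal (x - y) a))"

text \<open>A foliation is represented by its set of leaves.  A local submersion \<open>f\<close> on the relatively
  open subset \<open>A \<inter> V\<close> of the linear subspace \<open>A\<close> is given as the restriction of a smooth map on the
  open set \<open>V\<close> of the ambient space; its differential at \<open>x \<in> A \<inter> V\<close> is the restriction of
  \<open>frechet_derivative f (at x)\<close> to \<open>A\<close>.  The last clause makes the plaques of
  each leaf, i.e. the components of its intersection with \<open>V\<close>, whole fibres of \<open>f\<close> on \<open>A \<inter> V\<close>;
  in particular those fibres are connected.\<close>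

definition foliation_submersion ::
  "'a::euclidean_space set \<Rightarrow> 'a set set \<Rightarrow> 'a set \<Rightarrow> ('a \<Rightarrow> complex) \<Rightarrow> bool" where
  "foliation_submersion A F V f \<longleftrightarrow>
     open V \<and> smooth_on V f \<and>
     (\<forall>x\<in>A \<inter> V. frechet_derivative f (at x) ` A = UNIV) \<and>
     (\<forall>L\<in>F. \<forall>C\<in>components (L \<inter> V). \<exists>c. C = {x \<in> A \<inter> V. f x = c})"

text \<open>Leaves must be path connected and not merely connected in the subspace topology, since
  a union of several dense leaves can be connected in the latter.\<close>

definition foliation_codim2 :: "'a::euclidean_space set \<Rightarrow> 'a set set \<Rightarrow> bool" where
  "foliation_codim2 A F \<longleftrightarrow>
     subspace A \<and> partition_on A F \<and> (\<forall>L\<in>F. path_connected L) \<and>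
     (\<forall>p\<in>A. \<exists>V f. p \<in> V \<and> foliation_submersion A F V f)"

definition pullback_foliation :: "'a::euclidean_space set \<Rightarrow> 'a set set \<Rightarrow> 'a set set" where
  "pullback_foliation A F' = (\<lambda>L. orth_proj A -` L) ` F'"

definition full_foliation :: "'a::euclidean_space set set \<Rightarrow> bool" where
  "full_foliation F \<longleftrightarrow>
     \<not> (\<exists>A F'. subspace A \<and> A \<noteq> UNIV \<and> foliation_codim2 A F' \<and> F = pullback_foliation A F')"

definition horizontally_conformal_at :: "('a::euclidean_space \<Rightarrow> complex) \<Rightarrow> 'a \<Rightarrow> bool" where
  "horizontally_conformal_at f x \<longleftrightarrow>
     (let D = frechet_derivative f (at x); H = orthogonal_comp {v. D v = 0}
      in D ` H = UNIV \<and> (\<exists>r>0. \<forall>X\<in>H. \<forall>Y\<in>H. D X \<bullet> D Y = r\<^sup>2 * (X \<bullet> Y)))"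

text \<open>Horizontal conformality depends only on the conformal structure of the target surface, so
  after composing with a local conformal coordinate the target is \<open>\<complex>\<close>.\<close>

definition conformal_foliation :: "'a::euclidean_space set set \<Rightarrow> bool" where
  "conformal_foliation F \<longleftrightarrow>
     (\<forall>p. \<exists>V f. p \<in> V \<and> foliation_submersion UNIV F V f \<and>
        (\<forall>x\<in>V. horizontally_conformal_at f x))"

text \<open>Below, \<open>L\<close> is meant to be an immersed submanifold that occurs as a leaf of a
  foliation; a smooth curve of the ambient space that stays in a leaf is smooth as a curve in the
  leaf.\<close>

definition tangent_space :: "'a::euclidean_space set \<Rightarrow> 'a \<Rightarrow> 'a set" where
  "tangent_space L x =
     {v. \<exists>e>0. \<exists>\<gamma>::real \<Rightarrow> 'a. smooth_on {-e<..<e} \<gamma> \<and> \<gamma> ` {-e<..<e} \<subseteq> L \<and>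
           \<gamma> 0 = x \<and> (\<gamma> has_vector_derivative v) (at 0)}"

text \<open>The second fundamental form: the normal component of \<open>D\<^sub>u Y\<close>, for any local vector field
  \<open>Y\<close> which is tangent to \<open>L\<close> along \<open>L\<close> and extends \<open>v\<close>.\<close>

definition second_fundamental_form :: "'a::euclidean_space set \<Rightarrow> 'a \<Rightarrow> 'a \<Rightarrow> 'a \<Rightarrow> 'a" where
  "second_fundamental_form L x u v =
     (THE w. \<exists>U Y. open U \<and> x \<in> U \<and> smooth_on U Y \<and>
        (\<forall>y\<in>L \<inter> U. Y y \<in> tangent_space L y) \<and> Y x = v \<and>
        w = orth_proj (orthogonal_comp (tangent_space L x)) (frechet_derivative Y (at x) u))"

definition orthonormal_basis :: "'a::euclidean_space set \<Rightarrow> 'a set \<Rightarrow> bool" where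
  "orthonormal_basis T B \<longleftrightarrow> pairwise orthogonal B \<and> (\<forall>b\<in>B. norm b = 1) \<and> span B = T"

definition minimal_submanifold :: "'a::euclidean_space set \<Rightarrow> bool" where
  "minimal_submanifold L \<longleftrightarrow>
     (\<forall>x\<in>L. \<forall>B. orthonormal_basis (tangent_space L x) B \<longrightarrow>
        (1 / real (card B)) *\<^sub>R (\<Sum>b\<in>B. second_fundamental_form L x b b) = 0)"

definition kaehler_structure :: "('a::euclidean_space \<Rightarrow> 'a) \<Rightarrow> bool" where
  "kaehler_structure J \<longleftrightarrow> orthogonal_transformation J \<and> (\<forall>x. J (J x) = - x)"

definition kaehler_holomorphic_on ::
  "('a::euclidean_space \<Rightarrow> 'a) \<Rightarrow> 'a set \<Rightarrow> ('a \<Rightarrow> complex) \<Rightarrow> bool" where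
  "kaehler_holomorphic_on J W \<phi> \<longleftrightarrow>
     (\<forall>x\<in>W. \<phi> differentiable (at x) \<and>
        (\<forall>X. frechet_derivative \<phi> (at x) (J X) = \<i> * frechet_derivative \<phi> (at x) X))"

text \<open>For \<open>'a\<close> of dimension \<open>n\<close>, the space of dimension \<open>n + 1\<close> is the Euclidean product
  \<open>'a \<times> real\<close>, and the orthogonal projection onto \<open>'a\<close> is \<open>fst\<close>.\<close>

definition map_from_kaehler :: "'a::euclidean_space set \<Rightarrow> ('a \<Rightarrow> complex) \<Rightarrow> bool" where
  "map_from_kaehler U \<phi> \<longleftrightarrow>
     (even DIM('a) \<and>
        (\<exists>J. kaehler_structure J \<and> kaehler_holomorphic_on J U \<phi>)) \<or>
     (odd DIM('a) \<and>
        (\<exists>(J :: 'a \<times> real \<Rightarrow> 'a \<times> real) W. open W \<and> fst ` W = U \<and>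
           kaehler_structure J \<and> kaehler_holomorphic_on J W (\<phi> \<circ> fst)))"

definition foliation_from_kaehler :: "'a::euclidean_space set set \<Rightarrow> bool" where
  "foliation_from_kaehler F \<longleftrightarrow>
     (\<exists>U \<phi>. open U \<and> map_from_kaehler U \<phi> \<and>
        F = {C. \<exists>c. C \<in> components {x \<in> U. \<phi> x = c}})"

end

theory Submission
  imports Defs "HOL-Computational_Algebra.Polynomial"
begin

text \<open>For a polynomial null curve \<open>\<xi>\<close> in \<open>\<complex>\<^sup>n\<^sup>-\<^sup>2\<close>, that is \<open>(\<Sum>\<xi>\<^sub>i\<^sup>2) = 0\<close>, without zeros, the map
  \<open>\<phi> (x, z) = (\<Sum>x\<^sub>i \<xi>\<^sub>i z)\<close> on \<open>\<real>\<^sup>n\<^sup>-\<^sup>2 \<times> \<complex>\<close> is a harmonic morphism, so that its fibres are minimal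
  and form a conformal foliation.  It is full if the components \<open>\<xi>\<^sub>i\<close> are linearly independent
  over \<open>\<real>\<close>.  If the fibres arose from a Kaehler structure \<open>J\<close>, then the gradient of \<open>\<phi>\<close> at
  each point would lie in one of the two eigenspaces of \<open>J\<close>, and these are isotropic; but \<open>\<xi>\<close> can
  be chosen such that \<open>(\<Sum>\<xi>\<^sub>i z * \<xi>\<^sub>i w) \<noteq> 0\<close> for distinct real \<open>z, w \<ge> 0\<close>.\<close>

section \<open>Smooth functions\<close>

text \<open>The bound on n comes from the null curve. With only two components \<xi>1 and \<xi>2,
  nullity factors as (\<xi>1 + \<i> \<xi>2) (\<xi>1 - \<i> \<xi>2) = 0, so all values lie on one
  isotropic line and are mutually orthogonal. A third component is what breaks this, hence n - 2 >
  2. Minimality rests on the isotropy of the gradient g + \<i> h: its derivative, with the symmetry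
  of the Hessian \<open>H\<close>, gives \<open>H g g + H h h = 0\<close>. The Laplacian is
  therefore already the trace of the Hessian over the tangent space of the fibre, which measures the
  mean curvature. The obstacle in the last part is that a map \<psi> from a Kaehler structure shares
  only its leaves with \<phi>. It is constant along the fibres, so its differential factors through
  that of \<phi>; but where that differential vanishes, it says nothing about the gradient of
  \<phi>. Such points are reached by closure: being of one of the two types is a closed condition,
  and the differential of \<psi> cannot vanish on a ball, which would then lie in one leaf.\<close>

lemma Ck_on_cong:
  assumes "open S"
  shows "(\<And>x. x \<in> S \<Longrightarrow> f x = g x) \<Longrightarrow> Ck_on k f S \<Longrightarrow> Ck_on k g S"
proof (induction k arbitrary: f g)
  case 0
  then show ?case using continuous_on_cong[of S S f g] by simp
next
  case (Suc k)
  have "(g has_derivative frechet_derivative f (at x)) (at x)" if "x \<in> S" for x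
    using Suc.prems that assms
    by (auto simp: frechet_derivative_works intro: has_derivative_transform_within_open)
  then have g: "g differentiable (at x)"
    "frechet_derivative f (at x) = frechet_derivative g (at x)" if "x \<in> S" for x
    using that frechet_derivative_at by (auto simp: differentiable_def)
  have "Ck_on k (\<lambda>x. frechet_derivative g (at x) v) S" for v
  proof (rule Suc.IH)
    show "Ck_on k (\<lambda>x. frechet_derivative f (at x) v) S"
      using Suc.prems(2) by simp
  qed (simp add: g(2))
  then show ?case
    using g(1) by simp
qed

text \<open>Any explicit derivative \<open>f'\<close> may replace \<open>frechet_derivative\<close>
  in the recursion. The closure rules below are inductions on \<open>k\<close> in which the
  derivative is a formula that the induction hypothesis covers.\<close>

lemma Ck_on_Suc_iff:
  assumes "open S" and "\<And>x. x \<in> S \<Longrightarrow> (f has_derivative f' x) (at x)"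
  shows "Ck_on (Suc k) f S \<longleftrightarrow> (\<forall>v. Ck_on k (\<lambda>x. f' x v) S)"
proof -
  have "f' x = frechet_derivative f (at x)" if "x \<in> S" for x
    using frechet_derivative_at assms(2)[OF that] by blast
  then have "Ck_on k (\<lambda>x. frechet_derivative f (at x) v) S \<longleftrightarrow> Ck_on k (\<lambda>x. f' x v) S" for v
    using Ck_on_cong[OF assms(1), of "\<lambda>x. f' x v" "\<lambda>x. frechet_derivative f (at x) v" k]
      Ck_on_cong[OF assms(1), of "\<lambda>x. frechet_derivative f (at x) v" "\<lambda>x. f' x v" k] by auto
  then show ?thesis
    using assms(2) by (auto simp: differentiable_def)
qed

lemma Ck_on_has_derivative:
  "Ck_on (Suc k) f S \<Longrightarrow> x \<in> S \<Longrightarrow> (f has_derivative frechet_derivative f (at x)) (at x)"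
  by (simp add: frechet_derivative_works)

lemma Ck_on_SucD: "Ck_on (Suc k) f S \<Longrightarrow> Ck_on k f S"
proof (induction k arbitrary: f)
  case 0
  then show ?case
    by (auto intro!: continuous_at_imp_continuous_on differentiable_imp_continuous_within)
next
  case (Suc k)
  then have "\<forall>v. Ck_on (Suc k) (\<lambda>x. frechet_derivative f (at x) v) S"
    "\<forall>x\<in>S. f differentiable (at x)"
    using Ck_on.simps(2) by blast+
  then show ?case using Suc.IH by auto
qed

lemma Ck_on_const: "open S \<Longrightarrow> Ck_on k (\<lambda>x. c) S"
proof (induction k arbitrary: c)
  case (Suc k)
  show ?case
    by (subst Ck_on_Suc_iff[where f' = "\<lambda>x v. 0"]) (use Suc in auto)
qed auto

lemma Ck_on_linear:
  assumes "bounded_linear h" "open S" shows "Ck_on k h S"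
proof (cases k)
  case 0
  then show ?thesis using assms by (simp add: linear_continuous_on)
next
  case (Suc m)
  show ?thesis unfolding Suc
    by (subst Ck_on_Suc_iff[where f' = "\<lambda>x. h"])
      (use assms in \<open>auto intro: Ck_on_const bounded_linear_imp_has_derivative\<close>)
qed

lemma Ck_on_linear_comp:
  assumes h: "bounded_linear h" and S: "open S"
  shows "Ck_on k f S \<Longrightarrow> Ck_on k (\<lambda>x. h (f x)) S"
proof (induction k arbitrary: f)
  case 0
  then show ?case
    using h continuous_on_compose2[OF linear_continuous_on[OF h, of UNIV]] by auto
next
  case (Suc k)
  have "((\<lambda>x. h (f x)) has_derivative (\<lambda>v. h (frechet_derivative f (at x) v))) (at x)"
    if "x \<in> S" for x
    using Ck_on_has_derivative[OF Suc.prems that] bounded_linear.has_derivative[OF h] by blast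
  then show ?case
    using Suc by (subst Ck_on_Suc_iff[OF S]) auto
qed

lemma Ck_on_add:
  assumes S: "open S"
  shows "Ck_on k f S \<Longrightarrow> Ck_on k g S \<Longrightarrow> Ck_on k (\<lambda>x. f x + g x) S"
proof (induction k arbitrary: f g)
  case 0
  then show ?case by (simp add: continuous_on_add)
next
  case (Suc k)
  have "((\<lambda>x. f x + g x) has_derivative
      (\<lambda>v. frechet_derivative f (at x) v + frechet_derivative g (at x) v)) (at x)"
    if "x \<in> S" for x
    using Suc.prems[THEN Ck_on_has_derivative, OF that] by (rule has_derivative_add)
  then show ?case
    using Suc by (subst Ck_on_Suc_iff[OF S]) auto
qed

lemma Ck_on_bilinear:
  assumes S: "open S" and b: "bounded_bilinear (\<lambda>x y. prd x y)"
  shows "Ck_on k f S \<Longrightarrow> Ck_on k g S \<Longrightarrow> Ck_on k (\<lambda>x. prd (f x) (g x)) S"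
proof (induction k arbitrary: f g)
  case 0
  then show ?case by (simp add: bounded_bilinear.continuous_on[OF b])
next
  case (Suc k)
  have "((\<lambda>x. prd (f x) (g x)) has_derivative
      (\<lambda>v. prd (f x) (frechet_derivative g (at x) v) + prd (frechet_derivative f (at x) v) (g x)))
      (at x)"
    if "x \<in> S" for x
    using Suc.prems[THEN Ck_on_has_derivative, OF that] by (rule bounded_bilinear.FDERIV[OF b])
  moreover have "Ck_on k (\<lambda>x. prd (f x) (frechet_derivative g (at x) v)
      + prd (frechet_derivative f (at x) v) (g x)) S" for v
    using Suc.IH Suc.prems Ck_on_SucD[OF Suc.prems(1)] Ck_on_SucD[OF Suc.prems(2)]
    by (intro Ck_on_add[OF S]) auto
  ultimately show ?case
    by (subst Ck_on_Suc_iff[OF S]) auto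
qed

text \<open>The derivative of the inverse contains the inverse itself, but at one degree of
  smoothness less, so the product rule closes the induction.\<close>

lemma Ck_on_inverse:
  fixes f :: "'a::real_normed_vector \<Rightarrow> 'b::real_normed_field"
  assumes S: "open S" and nz: "\<And>x. x \<in> S \<Longrightarrow> f x \<noteq> 0"
  shows "Ck_on k f S \<Longrightarrow> Ck_on k (\<lambda>x. inverse (f x)) S"
proof (induction k)
  case 0
  then show ?case using nz by (auto intro!: continuous_intros)
next
  case (Suc k)
  have "((\<lambda>x. inverse (f x)) has_derivative
      (\<lambda>v. - (inverse (f x) * frechet_derivative f (at x) v * inverse (f x)))) (at x)"
    if "x \<in> S" for x
    using Ck_on_has_derivative[OF Suc.prems that] nz[OF that] by (intro Deriv.has_derivative_inverse)
  moreover have "Ck_on k (\<lambda>x. - (inverse (f x) * frechet_derivative f (at x) v * inverse (f x))) S"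
    for v
    using Suc.IH[OF Ck_on_SucD[OF Suc.prems]] Suc.prems
    by (intro Ck_on_linear_comp[OF bounded_linear_minus[OF bounded_linear_ident] S]
        Ck_on_bilinear[OF S bounded_bilinear_mult]) auto
  ultimately show ?case
    by (subst Ck_on_Suc_iff[OF S]) auto
qed

text \<open>Straight lines are the inner functions that matter: curves in a fibre arise by applying
  a retraction to \<open>p + t *\<^sub>R v\<close>.\<close>

lemma Ck_on_affine_comp:
  assumes T: "open T" and h: "bounded_linear h"
  shows "Ck_on k f UNIV \<Longrightarrow> Ck_on k (\<lambda>t. f (p + h t)) T"
proof (induction k arbitrary: f)
  case 0
  have "continuous_on T (\<lambda>t. p + h t)"
    by (intro continuous_intros linear_continuous_on h)
  with 0 show ?case
    using continuous_on_compose2 by fastforce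
next
  case (Suc k)
  have "((\<lambda>t. f (p + h t)) has_derivative
      (\<lambda>v. frechet_derivative f (at (p + h x)) (h v))) (at x)" for x
  proof -
    have "((\<lambda>t. p + h t) has_derivative h) (at x)"
      using has_derivative_add[OF has_derivative_const bounded_linear_imp_has_derivative[OF h]]
      by simp
    then show ?thesis
      using Ck_on_has_derivative[OF Suc.prems UNIV_I] has_derivative_compose by blast
  qed
  then show ?case
    using Suc by (subst Ck_on_Suc_iff[OF T]) auto
qed

lemma smooth_on_const: "open S \<Longrightarrow> smooth_on S (\<lambda>x. c)"
  by (simp add: smooth_on_def Ck_on_const)

lemma smooth_on_linear: "bounded_linear h \<Longrightarrow> open S \<Longrightarrow> smooth_on S h"
  by (simp add: smooth_on_def Ck_on_linear)

lemma smooth_on_linear_comp: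
  "bounded_linear h \<Longrightarrow> open S \<Longrightarrow> smooth_on S f \<Longrightarrow> smooth_on S (\<lambda>x. h (f x))"
  by (simp add: smooth_on_def Ck_on_linear_comp)

lemma smooth_on_add:
  "open S \<Longrightarrow> smooth_on S f \<Longrightarrow> smooth_on S g \<Longrightarrow> smooth_on S (\<lambda>x. f x + g x)"
  by (simp add: smooth_on_def Ck_on_add)

lemma smooth_on_minus: "open S \<Longrightarrow> smooth_on S f \<Longrightarrow> smooth_on S (\<lambda>x. - f x)"
  by (rule smooth_on_linear_comp[OF bounded_linear_minus[OF bounded_linear_ident]])

lemma smooth_on_diff:
  "open S \<Longrightarrow> smooth_on S f \<Longrightarrow> smooth_on S g \<Longrightarrow> smooth_on S (\<lambda>x. f x - g x)"
  using smooth_on_add[of S f "\<lambda>x. - g x"] smooth_on_minus[of S g] by simp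

lemma smooth_on_bilinear:
  "open S \<Longrightarrow> bounded_bilinear prd \<Longrightarrow> smooth_on S f \<Longrightarrow> smooth_on S g \<Longrightarrow>
    smooth_on S (\<lambda>x. prd (f x) (g x))"
  by (simp add: smooth_on_def Ck_on_bilinear)

lemma smooth_on_inverse:
  fixes f :: "'a::real_normed_vector \<Rightarrow> 'b::real_normed_field"
  shows "open S \<Longrightarrow> (\<And>x. x \<in> S \<Longrightarrow> f x \<noteq> 0) \<Longrightarrow> smooth_on S f \<Longrightarrow>
    smooth_on S (\<lambda>x. inverse (f x))"
  by (simp add: smooth_on_def Ck_on_inverse)

lemma smooth_on_sum:
  "open S \<Longrightarrow> (\<And>i. i \<in> I \<Longrightarrow> smooth_on S (f i)) \<Longrightarrow> smooth_on S (\<lambda>x. \<Sum>i\<in>I. f i x)"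
  by (induction I rule: infinite_finite_induct) (auto intro: smooth_on_const smooth_on_add)

lemma smooth_on_poly:
  fixes p :: "complex poly"
  shows "open S \<Longrightarrow> smooth_on S f \<Longrightarrow> smooth_on S (\<lambda>x. poly p (f x))"
proof (induction p)
  case 0
  then show ?case by (simp add: smooth_on_const)
next
  case (pCons a p)
  then show ?case
    by (simp add: smooth_on_add smooth_on_const smooth_on_bilinear[OF _ bounded_bilinear_mult])
qed

lemma smooth_on_affine_comp:
  "open T \<Longrightarrow> bounded_linear h \<Longrightarrow> smooth_on UNIV f \<Longrightarrow> smooth_on T (\<lambda>t. f (p + h t))"
  by (simp add: smooth_on_def Ck_on_affine_comp)

lemma smooth_on_has_derivative:
  "smooth_on S f \<Longrightarrow> x \<in> S \<Longrightarrow> (f has_derivative frechet_derivative f (at x)) (at x)"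
  using Ck_on_has_derivative smooth_on_def by blast

lemma smooth_on_frechet_derivative:
  "smooth_on S f \<Longrightarrow> smooth_on S (\<lambda>x. frechet_derivative f (at x) v)"
  unfolding smooth_on_def using Ck_on.simps(2) by blast

lemma smooth_on_continuous_on: "smooth_on S f \<Longrightarrow> continuous_on S f"
  using Ck_on.simps(1) smooth_on_def by blast

section \<open>Traces and orthonormal bases\<close>

lemma orthonormal_basis_expansion:
  fixes B :: "'a::euclidean_space set"
  assumes "orthonormal_basis T B" and "x \<in> T"
  shows "finite B" and "(\<Sum>b\<in>B. (x \<bullet> b) *\<^sub>R b) = x"
proof -
  have B: "pairwise orthogonal B" "\<And>b. b \<in> B \<Longrightarrow> norm b = 1" "span B = T"
    using assms(1) by (auto simp: orthonormal_basis_def)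
  have "independent B"
    using B by (intro pairwise_orthogonal_independent) force+
  then show fin: "finite B"
    using independent_imp_finite by blast
  show "(\<Sum>b\<in>B. (x \<bullet> b) *\<^sub>R b) = x"
    using orthonormal_basis_expand[OF B(1,2) _ fin, of x] B(3) assms(2)
    by (simp add: inner_commute)
qed

lemma orthonormal_basis_Parseval:
  fixes B :: "'a::euclidean_space set"
  assumes "orthonormal_basis UNIV B"
  shows "(\<Sum>b\<in>B. (x \<bullet> b) * (y \<bullet> b)) = x \<bullet> y"
proof -
  have "x \<bullet> y = (\<Sum>b\<in>B. (x \<bullet> b) *\<^sub>R b) \<bullet> y"
    by (simp add: orthonormal_basis_expansion(2)[OF assms])
  also have "\<dots> = (\<Sum>b\<in>B. (x \<bullet> b) * (y \<bullet> b))"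
    by (simp add: inner_sum_left inner_commute[of y])
  finally show ?thesis by simp
qed

text \<open>Both arguments are expanded in the standard basis, and Parseval contracts the sum over
  \<open>B\<close>. The result is applied to the Hessian in a basis adapted to a fibre, and to a
  basis rotated by a Kaehler structure.\<close>

lemma bilinear_trace_eq:
  fixes H :: "'a::euclidean_space \<Rightarrow> 'a \<Rightarrow> 'b::real_vector"
  assumes B: "orthonormal_basis UNIV B"
    and lin: "\<And>v. linear (\<lambda>u. H u v)" "\<And>u. linear (H u)"
  shows "(\<Sum>b\<in>B. H b b) = (\<Sum>e\<in>Basis. H e e)"
proof -
  have "H b b = (\<Sum>e\<in>Basis. \<Sum>f\<in>Basis. ((e \<bullet> b) * (f \<bullet> b)) *\<^sub>R H e f)" for b
  proof -
    have "H b b = H (\<Sum>e\<in>Basis. (e \<bullet> b) *\<^sub>R e) (\<Sum>f\<in>Basis. (f \<bullet> b) *\<^sub>R f)"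
      using euclidean_representation[of b] by (simp add: inner_commute)
    also have "\<dots> = (\<Sum>e\<in>Basis. (e \<bullet> b) *\<^sub>R H e (\<Sum>f\<in>Basis. (f \<bullet> b) *\<^sub>R f))"
      by (simp add: linear_sum[OF lin(1)] linear_cmul[OF lin(1)])
    also have "\<dots> = (\<Sum>e\<in>Basis. \<Sum>f\<in>Basis. ((e \<bullet> b) * (f \<bullet> b)) *\<^sub>R H e f)"
      by (simp add: linear_sum[OF lin(2)] linear_cmul[OF lin(2)] scaleR_sum_right)
    finally show ?thesis .
  qed
  then have "(\<Sum>b\<in>B. H b b) =
      (\<Sum>e\<in>Basis. \<Sum>f\<in>Basis. \<Sum>b\<in>B. ((e \<bullet> b) * (f \<bullet> b)) *\<^sub>R H e f)"
    by (simp add: sum.swap[of _ B])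
  also have "\<dots> = (\<Sum>e\<in>Basis. \<Sum>f\<in>Basis. (e \<bullet> f) *\<^sub>R H e f)"
    by (simp add: scaleR_sum_left[symmetric] orthonormal_basis_Parseval[OF B])
  also have "\<dots> = (\<Sum>e\<in>Basis. H e e)"
  proof (rule sum.cong)
    fix e :: 'a assume e: "e \<in> Basis"
    have "(\<Sum>f\<in>Basis. (e \<bullet> f) *\<^sub>R H e f) = (\<Sum>f\<in>Basis. if f = e then H e e else 0)"
      using e by (intro sum.cong) (auto simp: inner_Basis)
    then show "(\<Sum>f\<in>Basis. (e \<bullet> f) *\<^sub>R H e f) = H e e"
      using e by simp
  qed simp
  finally show ?thesis .
qed

lemma orth_proj_eqI:
  fixes x :: "'a::euclidean_space"
  assumes "subspace A" "y \<in> A" "\<And>a. a \<in> A \<Longrightarrow> orthogonal (x - y) a"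
  shows "orth_proj A x = y"
  unfolding orth_proj_def
proof (rule the_equality)
  fix z assume z: "z \<in> A \<and> (\<forall>a\<in>A. orthogonal (x - z) a)"
  then have "z - y \<in> A" using assms by (simp add: subspace_diff)
  then have "(x - y) \<bullet> (z - y) = 0" "(x - z) \<bullet> (z - y) = 0"
    using assms(3) z by (auto simp: orthogonal_def)
  then have "(z - y) \<bullet> (z - y) = 0"
    by (simp add: inner_diff_left)
  then show "z = y" by simp
qed (use assms in auto)

lemma orth_proj_exists:
  fixes x :: "'a::euclidean_space"
  assumes "subspace A"
  shows "orth_proj A x \<in> A" "\<And>a. a \<in> A \<Longrightarrow> orthogonal (x - orth_proj A x) a"
proof -
  have "span A = A"
    using assms by simp
  obtain y z where y: "y \<in> span A" "\<And>w. w \<in> span A \<Longrightarrow> orthogonal z w" "x = y + z"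
    using orthogonal_subspace_decomp_exists[of A x] by metis
  then have "y \<in> A" "\<And>a. a \<in> A \<Longrightarrow> orthogonal (x - y) a"
    using \<open>span A = A\<close> by auto
  moreover from this have "orth_proj A x = y"
    using orth_proj_eqI[OF assms] by blast
  ultimately show "orth_proj A x \<in> A" "\<And>a. a \<in> A \<Longrightarrow> orthogonal (x - orth_proj A x) a"
    by auto
qed

section \<open>Isotropic functionals\<close>

text \<open>\<open>g\<close> and \<open>h\<close> are the gradients of the real and imaginary parts.
  The sum of squares is the complex bilinear square of g + \<i> h; it vanishes exactly if
  \<open>g\<close> and \<open>h\<close> are orthogonal and of equal length.\<close>

lemma linear_functional_Complex:
  fixes E :: "'a::euclidean_space \<Rightarrow> complex"
  assumes "linear E"
  obtains g h where "\<And>v. E v = Complex (g \<bullet> v) (h \<bullet> v)"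
    "(\<Sum>b\<in>Basis. (E b)\<^sup>2) = Complex (g \<bullet> g - h \<bullet> h) (2 * (g \<bullet> h))"
proof
  let ?g = "\<Sum>b\<in>Basis. Re (E b) *\<^sub>R b" and ?h = "\<Sum>b\<in>Basis. Im (E b) *\<^sub>R b"
  show "E v = Complex (?g \<bullet> v) (?h \<bullet> v)" for v
  proof -
    have "E v = E (\<Sum>b\<in>Basis. (v \<bullet> b) *\<^sub>R b)"
      by (simp add: euclidean_representation)
    also have "\<dots> = (\<Sum>b\<in>Basis. (v \<bullet> b) *\<^sub>R E b)"
      by (simp add: linear_sum[OF assms] linear_cmul[OF assms])
    finally show ?thesis
      by (simp add: complex_eq_iff inner_sum_left inner_commute[of v] mult.commute)
  qed
  show "(\<Sum>b\<in>Basis. (E b)\<^sup>2) = Complex (?g \<bullet> ?g - ?h \<bullet> ?h) (2 * (?g \<bullet> ?h))"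
    by (subst (1 2 3) euclidean_inner)
      (simp add: complex_eq_iff power2_eq_square sum_subtractf sum_distrib_left mult_ac)
qed

lemma isotropic_functional:
  fixes E :: "'a::euclidean_space \<Rightarrow> complex"
  assumes "linear E" "(\<Sum>b\<in>Basis. (E b)\<^sup>2) = 0" "E u \<noteq> 0"
  obtains g h r where "\<And>v. E v = Complex (g \<bullet> v) (h \<bullet> v)" "g \<bullet> h = 0" "r > 0"
    "g \<bullet> g = r\<^sup>2" "h \<bullet> h = r\<^sup>2"
proof -
  obtain g h where gh: "\<And>v. E v = Complex (g \<bullet> v) (h \<bullet> v)"
    "(\<Sum>b\<in>Basis. (E b)\<^sup>2) = Complex (g \<bullet> g - h \<bullet> h) (2 * (g \<bullet> h))"
    using linear_functional_Complex[OF assms(1)] by blast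
  then have eq: "g \<bullet> g = h \<bullet> h" "g \<bullet> h = 0"
    using assms(2) by (auto simp: complex_eq_iff)
  have "g \<noteq> 0"
  proof
    assume "g = 0"
    with eq have "h = 0" by simp
    with \<open>g = 0\<close> gh assms(3) show False by (simp add: complex_eq_iff)
  qed
  then show ?thesis
    using gh eq by (intro that[of g h "norm g"]) (auto simp: power2_norm_eq_inner)
qed

text \<open>Subtracting from \<open>x\<close> its projection to the plane of \<open>g\<close> and
  \<open>h\<close> leaves a vector of the kernel. It is orthogonal to \<open>g\<close>, to
  \<open>h\<close> and, by assumption, to \<open>x\<close>, hence to itself.\<close>

lemma isotropic_orthogonal_comp_kernel:
  fixes g h :: "'a::euclidean_space"
  assumes "g \<bullet> h = 0" "r > 0" "g \<bullet> g = r\<^sup>2" "h \<bullet> h = r\<^sup>2"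
  shows "orthogonal_comp {v. Complex (g \<bullet> v) (h \<bullet> v) = 0} = range (\<lambda>(s, t). s *\<^sub>R g + t *\<^sub>R h)"
    (is "?K = ?N")
proof
  show "?N \<subseteq> ?K"
    by (auto simp: orthogonal_comp_def orthogonal_def inner_right_distrib inner_commute complex_eq_iff)
  show "?K \<subseteq> ?N"
  proof
    fix x assume x: "x \<in> ?K"
    define y where "y = x - ((g \<bullet> x / r\<^sup>2) *\<^sub>R g + (h \<bullet> x / r\<^sup>2) *\<^sub>R h)"
    have "g \<bullet> y = 0" "h \<bullet> y = 0"
      using assms by (simp_all add: y_def inner_diff_right inner_right_distrib inner_commute)
    moreover from this have "y \<bullet> x = 0"
      using x by (auto simp: orthogonal_comp_def orthogonal_def complex_eq_iff)
    moreover have "y \<bullet> y = y \<bullet> x - ((g \<bullet> x / r\<^sup>2) * (g \<bullet> y) + (h \<bullet> x / r\<^sup>2) * (h \<bullet> y))"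
      by (subst (2) y_def) (simp add: inner_diff_right inner_right_distrib inner_commute[of y])
    ultimately have "y \<bullet> y = 0" by simp
    then have "x = (g \<bullet> x / r\<^sup>2) *\<^sub>R g + (h \<bullet> x / r\<^sup>2) *\<^sub>R h"
      by (simp add: y_def)
    then show "x \<in> ?N"
      by (metis (mono_tags, lifting) case_prod_conv rangeI)
  qed
qed

text \<open>On the plane of \<open>g\<close> and \<open>h\<close>, the functional sends s g + t h to
  r^2 (s + \<i> t), while the vector has length r |s + \<i> t|. So \<open>E\<close> is there a
  similarity with factor \<open>r\<close>.\<close>

lemma isotropic_horizontally_conformal:
  fixes E :: "'a::euclidean_space \<Rightarrow> complex"
  assumes "linear E" "(\<Sum>b\<in>Basis. (E b)\<^sup>2) = 0" "E u \<noteq> 0"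
  shows "E ` orthogonal_comp {v. E v = 0} = UNIV"
    and "\<exists>r>0. \<forall>X\<in>orthogonal_comp {v. E v = 0}. \<forall>Y\<in>orthogonal_comp {v. E v = 0}.
      E X \<bullet> E Y = r\<^sup>2 * (X \<bullet> Y)"
proof -
  obtain g h r where E: "\<And>v. E v = Complex (g \<bullet> v) (h \<bullet> v)" and gh: "g \<bullet> h = 0" "r > 0"
    "g \<bullet> g = r\<^sup>2" "h \<bullet> h = r\<^sup>2"
    using isotropic_functional[OF assms] by metis
  note K = isotropic_orthogonal_comp_kernel[OF gh]
  have "w \<in> E ` orthogonal_comp {v. E v = 0}" for w
  proof
    show "w = E ((Re w / r\<^sup>2) *\<^sub>R g + (Im w / r\<^sup>2) *\<^sub>R h)"
      using gh by (simp add: E complex_eq_iff inner_right_distrib inner_commute)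
    show "(Re w / r\<^sup>2) *\<^sub>R g + (Im w / r\<^sup>2) *\<^sub>R h \<in> orthogonal_comp {v. E v = 0}"
      unfolding E K by (metis (mono_tags, lifting) case_prod_conv rangeI)
  qed
  then show "E ` orthogonal_comp {v. E v = 0} = UNIV" by blast
  show "\<exists>r>0. \<forall>X\<in>orthogonal_comp {v. E v = 0}. \<forall>Y\<in>orthogonal_comp {v. E v = 0}.
      E X \<bullet> E Y = r\<^sup>2 * (X \<bullet> Y)"
    unfolding E K using gh
    by (intro exI[of _ r])
      (auto simp: inner_complex_def inner_right_distrib inner_left_distrib inner_commute
        algebra_simps power2_eq_square)
qed

text \<open>The kernel of an isotropic functional is completed to an orthonormal basis by the normalised
  real and imaginary parts of its gradient.\<close>

lemma trace_kernel_isotropic: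
  fixes H :: "'a::euclidean_space \<Rightarrow> 'a \<Rightarrow> complex"
  assumes gh: "g \<bullet> h = 0" "r > 0" "g \<bullet> g = r\<^sup>2" "h \<bullet> h = r\<^sup>2"
    and B: "orthonormal_basis {v. Complex (g \<bullet> v) (h \<bullet> v) = 0} B"
    and lin: "\<And>v. linear (\<lambda>u. H u v)" "\<And>u. linear (H u)"
  shows "(\<Sum>b\<in>B. H b b) = (\<Sum>e\<in>Basis. H e e) - (H g g + H h h) /\<^sub>R r\<^sup>2"
proof -
  define m n where "m = g /\<^sub>R r" and "n = h /\<^sub>R r"
  have B': "pairwise orthogonal B" "\<And>b. b \<in> B \<Longrightarrow> norm b = 1"
    "span B = {v. Complex (g \<bullet> v) (h \<bullet> v) = 0}"
    using B by (auto simp: orthonormal_basis_def)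
  have ker: "g \<bullet> b = 0" "h \<bullet> b = 0" if "b \<in> B" for b
    using span_base[OF that] B' by (auto simp: complex_eq_iff)
  have mn: "m \<bullet> m = 1" "n \<bullet> n = 1" "m \<bullet> n = 0"
    using gh by (simp_all add: m_def n_def power2_eq_square field_simps)
  have mnB: "m \<bullet> b = 0" "n \<bullet> b = 0" if "b \<in> B" for b
    using ker[OF that] by (simp_all add: m_def n_def)
  have notin: "m \<notin> B" "n \<notin> B" "m \<noteq> n"
    using mnB mn by auto
  have fin: "finite B"
    by (rule orthonormal_basis_expansion(1)[OF B, of 0]) (simp add: complex_eq_iff)
  have "orthonormal_basis UNIV (insert m (insert n B))"
    unfolding orthonormal_basis_def
  proof (intro conjI ballI)
    show "pairwise orthogonal (insert m (insert n B))"
      using B'(1) mn mnB by (auto simp: pairwise_insert orthogonal_def inner_commute)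
    show "norm b = 1" if "b \<in> insert m (insert n B)" for b
      using that B'(2) mn by (auto simp: norm_eq_1)
    show "span (insert m (insert n B)) = UNIV"
    proof (intro equalityI subset_UNIV subsetI)
      fix x :: 'a
      let ?y = "x - ((m \<bullet> x) *\<^sub>R m + (n \<bullet> x) *\<^sub>R n)"
      have "m \<bullet> ?y = 0" "n \<bullet> ?y = 0"
        using mn by (simp_all add: inner_diff_right inner_right_distrib inner_commute)
      then have "?y \<in> span B"
        using gh(2) by (simp add: B'(3) m_def n_def complex_eq_iff)
      then have "?y \<in> span (insert m (insert n B))"
        using span_mono[of B "insert m (insert n B)"] by blast
      moreover have "(m \<bullet> x) *\<^sub>R m + (n \<bullet> x) *\<^sub>R n \<in> span (insert m (insert n B))"
        by (intro span_add span_scale span_base) auto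
      ultimately show "x \<in> span (insert m (insert n B))"
        using span_add by fastforce
    qed
  qed
  then have "(\<Sum>b\<in>insert m (insert n B). H b b) = (\<Sum>e\<in>Basis. H e e)"
    by (rule bilinear_trace_eq) (rule lin)+
  moreover have "H m m + H n n = (H g g + H h h) /\<^sub>R r\<^sup>2"
    by (simp add: m_def n_def linear_cmul[OF lin(1)] linear_cmul[OF lin(2)] power2_eq_square
        scaleR_add_right)
  ultimately have "(H g g + H h h) /\<^sub>R r\<^sup>2 + (\<Sum>b\<in>B. H b b) = (\<Sum>e\<in>Basis. H e e)"
    using fin notin by (simp add: add.assoc[symmetric])
  then show ?thesis
    by (metis add_diff_cancel_left')
qed

section \<open>Kaehler structures and isotropic functionals\<close>

text \<open>\<open>J\<close> carries the standard basis to an orthonormal basis, which leaves the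
  trace unchanged but multiplies each term by \<sigma>^2 = -1. This is the isotropy of the
  eigenspaces of \<open>J\<close>, stated for functionals.\<close>

lemma kaehler_structure_trace_zero:
  fixes J :: "'b::euclidean_space \<Rightarrow> 'b" and E D :: "'b \<Rightarrow> complex"
  assumes J: "kaehler_structure J" and lin: "linear E" "linear D"
    and E: "\<And>v. E (J v) = \<sigma> * E v" and D: "\<And>v. D (J v) = \<sigma> * D v" and "\<sigma>\<^sup>2 = -1"
  shows "(\<Sum>b\<in>Basis. E b * D b) = 0"
proof -
  have J': "orthogonal_transformation J"
    using J by (simp add: kaehler_structure_def)
  then have inj: "inj J" and linJ: "linear J" and inner: "\<And>u v. J u \<bullet> J v = u \<bullet> v"
    by (auto simp: orthogonal_transformation_inj orthogonal_transformation_def)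
  have "orthonormal_basis UNIV (J ` Basis)"
    unfolding orthonormal_basis_def
  proof (intro conjI ballI)
    show "pairwise orthogonal (J ` Basis)"
      by (auto simp: pairwise_def orthogonal_def inner inner_Basis)
    show "norm b = 1" if "b \<in> J ` Basis" for b
      using that inner by (auto simp: norm_eq_1 inner_Basis)
    show "span (J ` Basis) = UNIV"
      using linear_span_image[OF linJ, of Basis] orthogonal_transformation_surj[OF J'] by simp
  qed
  then have "(\<Sum>b\<in>J ` Basis. E b * D b) = (\<Sum>b\<in>Basis. E b * D b)"
    by (rule bilinear_trace_eq)
      (auto intro!: linearI simp: linear_add[OF lin(1)] linear_cmul[OF lin(1)]
        linear_add[OF lin(2)] linear_cmul[OF lin(2)] algebra_simps)
  moreover have "(\<Sum>b\<in>J ` Basis. E b * D b) = \<sigma>\<^sup>2 * (\<Sum>b\<in>Basis. E b * D b)"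
    using inj by (simp add: sum.reindex inj_on_def E D sum_distrib_left power2_eq_square mult_ac)
  ultimately show ?thesis
    using assms(6) by simp
qed

text \<open>Both functionals are isotropic with the same kernel; so one is a complex multiple of the other
  or of its conjugate.\<close>

lemma isotropic_holomorphic_or_antiholomorphic:
  fixes J :: "'b::euclidean_space \<Rightarrow> 'b" and E D :: "'b \<Rightarrow> complex"
  assumes J: "kaehler_structure J" and lin: "linear E" "linear D"
    and D: "\<And>v. D (J v) = \<i> * D v" "D u \<noteq> 0"
    and E: "(\<Sum>b\<in>Basis. (E b)\<^sup>2) = 0" "surj E"
    and ker: "\<And>v. E v = 0 \<Longrightarrow> D v = 0"
  shows "(\<forall>v. E (J v) = \<i> * E v) \<or> (\<forall>v. E (J v) = - \<i> * E v)"
proof -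
  obtain e f where ef: "E e = 1" "E f = \<i>"
    using E(2) by (metis surj_def)
  \<comment> \<open>These are the Wirtinger coefficients of \<open>D\<close> with respect to
    \<open>E\<close>: \<open>D\<close> is the combination of \<open>E\<close> and its conjugate that
    has the right values at \<open>e\<close> and \<open>f\<close>.\<close>
  define \<alpha> \<beta> where "\<alpha> = (D e - \<i> * D f) / 2" and "\<beta> = (D e + \<i> * D f) / 2"
  have DE: "D v = \<alpha> * E v + \<beta> * cnj (E v)" for v
  proof -
    have "E (v - (Re (E v) *\<^sub>R e + Im (E v) *\<^sub>R f)) = 0"
      using ef by (simp add: linear_diff[OF lin(1)] linear_add[OF lin(1)] linear_cmul[OF lin(1)]
          complex_eq_iff)
    then have "D v = Re (E v) *\<^sub>R D e + Im (E v) *\<^sub>R D f"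
      using ker by (fastforce simp: linear_diff[OF lin(2)] linear_add[OF lin(2)] linear_cmul[OF lin(2)])
    then show ?thesis
      by (simp add: \<alpha>_def \<beta>_def complex_eq_iff field_simps)
  qed
  \<comment> \<open>\<open>D\<close> is isotropic as an eigenfunctional of \<open>J\<close>. The
    isotropy of \<open>E\<close> removes the pure squares, so only the mixed term is left, and its
    sum is a nonzero real number.\<close>
  have "0 = (\<Sum>b\<in>Basis. D b * D b)"
    using kaehler_structure_trace_zero[OF J lin(2) lin(2) D(1) D(1)] by simp
  also have "\<dots> = \<alpha>\<^sup>2 * (\<Sum>b\<in>Basis. (E b)\<^sup>2) + \<beta>\<^sup>2 * cnj (\<Sum>b\<in>Basis. (E b)\<^sup>2)
      + 2 * \<alpha> * \<beta> * (\<Sum>b\<in>Basis. E b * cnj (E b))"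
    by (simp add: DE sum_distrib_left sum.distrib[symmetric] power2_eq_square algebra_simps)
  also have "(\<Sum>b\<in>Basis. E b * cnj (E b)) = of_real (\<Sum>b\<in>Basis. (cmod (E b))\<^sup>2)"
    by (simp add: complex_norm_square del: of_real_power)
  finally have "\<alpha> * \<beta> * of_real (\<Sum>b\<in>Basis. (cmod (E b))\<^sup>2) = 0"
    using E(1) by simp
  moreover have "(\<Sum>b\<in>Basis. (cmod (E b))\<^sup>2) \<noteq> 0"
  proof
    assume "(\<Sum>b\<in>Basis. (cmod (E b))\<^sup>2) = 0"
    then have "E b = 0" if "b \<in> Basis" for b
      using that by (simp add: sum_nonneg_eq_0_iff)
    then have "E e = 0"
      using linear_eq_0_on_span[OF lin(1), of Basis e] by simp
    with ef show False by simp
  qed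
  ultimately consider "\<alpha> = 0" | "\<beta> = 0"
    by (metis mult_eq_0_iff of_real_eq_0_iff)
  then show ?thesis
  proof cases
    case 1
    then have "cnj (E (J v)) = \<i> * cnj (E v)" for v
      using D DE by auto
    then have "E (J v) = - \<i> * E v" for v
      by (metis complex_cnj_cnj complex_cnj_i complex_cnj_mult)
    then show ?thesis by blast
  next
    case 2
    then show ?thesis using D DE by auto
  qed
qed

section \<open>Harmonic morphisms with a lift of translations\<close>

text \<open>The lift \<open>R\<close> replaces the implicit function theorem: it gives the smooth retraction
  \<open>y \<mapsto> y - R y (\<phi> y - c)\<close> onto the fibre over \<open>c\<close>.\<close>

locale lifted_harmonic_morphism =
  fixes \<phi> :: "'a::euclidean_space \<Rightarrow> complex" and R :: "'a \<Rightarrow> complex \<Rightarrow> 'a"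
  assumes smooth: "smooth_on UNIV \<phi>"
    and isotropic: "(\<Sum>b\<in>Basis. (frechet_derivative \<phi> (at p) b)\<^sup>2) = 0"
    and harmonic:
      "(\<Sum>b\<in>Basis. frechet_derivative (\<lambda>q. frechet_derivative \<phi> (at q) b) (at p) b) = 0"
    and hessian_commute:
      "frechet_derivative (\<lambda>q. frechet_derivative \<phi> (at q) v) (at p) u =
       frechet_derivative (\<lambda>q. frechet_derivative \<phi> (at q) u) (at p) v"
    and smooth_lift: "smooth_on UNIV (\<lambda>p. R p w)"
    and linear_lift: "linear (R p)"
    and lift: "\<phi> (p + R p w) = \<phi> p + w"
begin

section \<open>Gradient and Hessian of a harmonic morphism\<close>

definition D :: "'a \<Rightarrow> 'a \<Rightarrow> complex" where
  "D p = frechet_derivative \<phi> (at p)"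

definition H :: "'a \<Rightarrow> 'a \<Rightarrow> 'a \<Rightarrow> complex" where
  "H p u v = frechet_derivative (\<lambda>q. D q v) (at p) u"

lemma has_derivative_D: "(\<phi> has_derivative D p) (at p)"
  using smooth_on_has_derivative[OF smooth] by (simp add: D_def)

lemma linear_D: "linear (D p)"
  using has_derivative_D has_derivative_linear by blast

lemma D_expand: "D p v = (\<Sum>b\<in>Basis. (v \<bullet> b) *\<^sub>R D p b)"
  using linear_sum[OF linear_D, of p "\<lambda>b. (v \<bullet> b) *\<^sub>R b" Basis]
  by (simp add: euclidean_representation linear_cmul[OF linear_D])

lemma smooth_D: "smooth_on UNIV (\<lambda>p. D p v)"
  unfolding D_def by (rule smooth_on_frechet_derivative[OF smooth])

lemma has_derivative_H: "((\<lambda>q. D q v) has_derivative (\<lambda>u. H p u v)) (at p)"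
  using smooth_on_has_derivative[OF smooth_D] by (simp add: H_def)

lemma linear_H_left: "linear (\<lambda>u. H p u v)"
  using has_derivative_H has_derivative_linear by blast

lemma H_commute: "H p u v = H p v u"
  using hessian_commute by (simp add: H_def D_def)

lemma linear_H_right: "linear (H p u)"
  using linear_H_left[of p u] by (subst H_commute[abs_def])

lemma H_expand: "H p u v = (\<Sum>b\<in>Basis. (v \<bullet> b) *\<^sub>R H p u b)"
  using linear_sum[OF linear_H_right, of p u "\<lambda>b. (v \<bullet> b) *\<^sub>R b" Basis]
  by (simp add: euclidean_representation linear_cmul[OF linear_H_right])

lemma isotropic_D: "(\<Sum>b\<in>Basis. (D p b)\<^sup>2) = 0"
  using isotropic by (simp add: D_def)

lemma trace_H: "(\<Sum>b\<in>Basis. H p b b) = 0"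
  using harmonic by (simp add: H_def D_def)

text \<open>The identity \<open>lift\<close> is differentiated at \<open>w = 0\<close>. The lift is
  thus a right inverse of the differential, which makes \<phi> a submersion everywhere.\<close>

lemma D_lift: "D p (R p w) = w"
proof -
  have "bounded_linear (R p)"
    using linear_lift linear_conv_bounded_linear by blast
  then have "((\<lambda>w. p + R p w) has_derivative R p) (at 0)"
    using has_derivative_add[OF has_derivative_const bounded_linear_imp_has_derivative] by fastforce
  moreover have "(\<phi> has_derivative D p) (at (p + R p 0))"
    using has_derivative_D linear_0[OF linear_lift] by simp
  ultimately have "((\<lambda>w. \<phi> (p + R p w)) has_derivative (\<lambda>w. D p (R p w))) (at 0)"
    by (rule has_derivative_compose)
  moreover have "((\<lambda>w. \<phi> (p + R p w)) has_derivative (\<lambda>w. w)) (at 0)"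
    unfolding lift by (auto intro!: derivative_eq_intros)
  ultimately show ?thesis
    by (metis has_derivative_unique)
qed

lemma surj_D: "surj (D p)"
  using D_lift by (metis surjI)

lemma D_Complex:
  obtains g h r where "\<And>v. D p v = Complex (g \<bullet> v) (h \<bullet> v)" "g \<bullet> h = 0" "r > 0"
    "g \<bullet> g = r\<^sup>2" "h \<bullet> h = r\<^sup>2"
  by (rule isotropic_functional[OF linear_D isotropic_D, of p "R p 1"]) (auto simp: D_lift)

lemma horizontally_conformal: "horizontally_conformal_at \<phi> p"
  unfolding horizontally_conformal_at_def Let_def D_def[symmetric]
  using isotropic_horizontally_conformal[OF linear_D isotropic_D, of p "R p 1"]
  by (auto simp: D_lift)

section \<open>The retraction onto a fibre\<close>

lemma lift_eq: "R p w = Re w *\<^sub>R R p 1 + Im w *\<^sub>R R p \<i>"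
proof -
  have "w = Re w *\<^sub>R 1 + Im w *\<^sub>R \<i>"
    by (simp add: complex_eq_iff)
  then show ?thesis
    by (metis linear_add[OF linear_lift] linear_cmul[OF linear_lift])
qed

text \<open>Smoothness of the lift is assumed only for a constant vector \<open>w\<close>. By real
  linearity, a varying argument needs just the two fields \<open>R y 1\<close> and
  \<open>R y \<i>\<close>.\<close>

lemma smooth_on_lift:
  assumes "smooth_on UNIV f" shows "smooth_on UNIV (\<lambda>y. R y (f y))"
  unfolding lift_eq[of _ "f _"]
  by (intro smooth_on_add smooth_on_bilinear[OF open_UNIV bounded_bilinear_scaleR] smooth_lift
      smooth_on_linear_comp[OF bounded_linear_Re] smooth_on_linear_comp[OF bounded_linear_Im]
      assms open_UNIV)

text \<open>The terms in which \<open>R\<close> itself is differentiated carry the factor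
  \<open>f p = 0\<close>.\<close>

lemma has_derivative_lift:
  assumes f: "(f has_derivative f') (at p)" and "f p = 0"
  shows "((\<lambda>y. R y (f y)) has_derivative (\<lambda>v. R p (f' v))) (at p)"
proof -
  have R: "((\<lambda>y. R y w) has_derivative frechet_derivative (\<lambda>y. R y w) (at p)) (at p)" for w
    using smooth_on_has_derivative[OF smooth_lift] by simp
  have "((\<lambda>y. Re (f y) *\<^sub>R R y 1 + Im (f y) *\<^sub>R R y \<i>) has_derivative
      (\<lambda>v. (Re (f p) *\<^sub>R frechet_derivative (\<lambda>y. R y 1) (at p) v + Re (f' v) *\<^sub>R R p 1)
        + (Im (f p) *\<^sub>R frechet_derivative (\<lambda>y. R y \<i>) (at p) v + Im (f' v) *\<^sub>R R p \<i>))) (at p)"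
    by (intro has_derivative_add has_derivative_scaleR R bounded_linear.has_derivative[OF bounded_linear_Re f]
        bounded_linear.has_derivative[OF bounded_linear_Im f])
  then show ?thesis
    unfolding lift_eq[of _ "f _"] lift_eq[of _ "f' _"] by (simp add: assms(2))
qed

definition retr :: "complex \<Rightarrow> 'a \<Rightarrow> 'a" where
  "retr c y = y - R y (\<phi> y - c)"

lemma retr_in_fibre: "\<phi> (retr c y) = c"
  using lift[of y "- (\<phi> y - c)"] linear_neg[OF linear_lift, of y "\<phi> y - c"]
  by (simp add: retr_def)

lemma retr_fixed: "\<phi> y = c \<Longrightarrow> retr c y = y"
  by (simp add: retr_def linear_0[OF linear_lift])

lemma smooth_retr: "smooth_on UNIV (retr c)"
  unfolding retr_def[abs_def]
  by (intro smooth_on_diff smooth_on_lift smooth smooth_on_const open_UNIV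
      smooth_on_linear[OF bounded_linear_ident])

text \<open>At a point of the fibre the retraction has the derivative
  \<open>v - R p (D p v)\<close>, a projection onto the kernel of \<open>D p\<close>; it fixes the
  kernel vector \<open>v\<close>.\<close>

lemma has_derivative_retr:
  assumes "\<phi> p = c" "D p v = 0"
  shows "((\<lambda>t. retr c (p + t *\<^sub>R v)) has_derivative (\<lambda>t. t *\<^sub>R v)) (at 0)"
proof -
  have "((\<lambda>y. \<phi> y - c) has_derivative D p) (at p)"
    using has_derivative_diff[OF has_derivative_D has_derivative_const] by simp
  then have "((\<lambda>y. R y (\<phi> y - c)) has_derivative (\<lambda>v. R p (D p v))) (at p)"
    by (rule has_derivative_lift) (simp add: assms)
  then have "(retr c has_derivative (\<lambda>v. v - R p (D p v))) (at p)"
    unfolding retr_def[abs_def] by (rule has_derivative_diff[OF has_derivative_ident])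
  moreover have "((\<lambda>t. p + t *\<^sub>R v) has_derivative (\<lambda>t. t *\<^sub>R v)) (at 0)"
    by (auto intro!: derivative_eq_intros)
  ultimately have "((\<lambda>t. retr c (p + t *\<^sub>R v)) has_derivative
      (\<lambda>t. t *\<^sub>R v - R p (D p (t *\<^sub>R v)))) (at 0)"
    using has_derivative_compose[of "\<lambda>t. p + t *\<^sub>R v" _ 0 UNIV "retr c"] by simp
  then show ?thesis
    by (simp add: linear_cmul[OF linear_D] assms linear_0[OF linear_lift])
qed

text \<open>The fibre is the continuous image of the whole space under the retraction.\<close>

lemma path_connected_fibre: "path_connected {y. \<phi> y = c}"
proof -
  have "{y. \<phi> y = c} = range (retr c)"
    using retr_in_fibre retr_fixed by (auto simp: image_def) metis
  then show ?thesis
    using path_connected_continuous_image[OF smooth_on_continuous_on[OF smooth_retr]]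
    by (simp add: convex_imp_path_connected)
qed

section \<open>Tangent spaces and mean curvature of the fibres\<close>

lemma tangent_space_fibre:
  assumes "\<phi> x = c"
  shows "tangent_space {y. \<phi> y = c} x = {v. D x v = 0}"
proof (intro equalityI subsetI CollectI)
  fix v assume "v \<in> tangent_space {y. \<phi> y = c} x"
  then obtain e \<gamma> where e: "e > 0" "\<gamma> ` {-e<..<e} \<subseteq> {y. \<phi> y = c}" "\<gamma> 0 = x"
    and d: "(\<gamma> has_vector_derivative v) (at 0)"
    unfolding tangent_space_def by blast
  have fibre: "\<phi> (\<gamma> t) = c" if "t \<in> {-e<..<e}" for t
    using e(2) that by blast
  have "((\<lambda>t. \<phi> (\<gamma> t)) has_derivative (\<lambda>t. D x (t *\<^sub>R v))) (at 0)"
    using has_derivative_compose[OF d[unfolded has_vector_derivative_def], of \<phi> "D x"]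
      has_derivative_D e(3) by simp
  moreover have "((\<lambda>t. \<phi> (\<gamma> t)) has_derivative (\<lambda>t. 0)) (at 0)"
    by (rule has_derivative_transform_within_open[where s = "{-e<..<e}" and f = "\<lambda>t. c"])
      (use e(1) fibre in auto)
  ultimately have "D x (1 *\<^sub>R v) = 0"
    by (metis has_derivative_unique)
  then show "D x v = 0" by simp
next
  fix v assume "v \<in> {v. D x v = 0}"
  then have v: "D x v = 0" by simp
  \<comment> \<open>Retracting the straight line with direction \<open>v\<close> gives a smooth
    curve in the fibre that still has velocity \<open>v\<close> at 0.\<close>
  define \<gamma> where "\<gamma> t = retr c (x + t *\<^sub>R v)" for t :: real
  have "smooth_on {-1<..<1} \<gamma>"
    unfolding \<gamma>_def by (intro smooth_on_affine_comp smooth_retr bounded_linear_scaleR_left) auto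
  moreover have "\<gamma> 0 = x" "\<gamma> ` {-1<..<1} \<subseteq> {y. \<phi> y = c}"
    using assms retr_in_fibre retr_fixed by (auto simp: \<gamma>_def)
  moreover have "(\<gamma> has_vector_derivative v) (at 0)"
    using has_derivative_retr[OF assms v] by (simp add: has_vector_derivative_def \<gamma>_def[abs_def])
  ultimately show "v \<in> tangent_space {y. \<phi> y = c} x"
    unfolding tangent_space_def by (intro CollectI exI[of _ "1::real"]) auto
qed

text \<open>The equation \<open>D y (Y y) = 0\<close> is differentiated by the product rule. As it
  holds only on the fibre, this is done along a curve in the fibre with velocity \<open>u\<close>.
  The right-hand side involves \<open>Y\<close> only through its value at \<open>x\<close>.\<close>

lemma derivative_tangent_field:
  assumes x: "\<phi> x = c" and u: "D x u = 0" and U: "open U" "x \<in> U" and Y: "smooth_on U Y"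
    and tangent: "\<And>y. y \<in> U \<Longrightarrow> \<phi> y = c \<Longrightarrow> D y (Y y) = 0"
  shows "D x (frechet_derivative Y (at x) u) = - H x u (Y x)"
proof -
  let ?Y' = "frechet_derivative Y (at x)"
  have Y': "(Y has_derivative ?Y') (at x)"
    using smooth_on_has_derivative[OF Y U(2)] .
  have "((\<lambda>y. \<Sum>b\<in>Basis. (Y y \<bullet> b) *\<^sub>R D y b) has_derivative
      (\<lambda>u. \<Sum>b\<in>Basis. (Y x \<bullet> b) *\<^sub>R H x u b + (?Y' u \<bullet> b) *\<^sub>R D x b)) (at x)"
    by (intro has_derivative_sum has_derivative_scaleR has_derivative_inner_left Y' has_derivative_H)
  then have K: "((\<lambda>y. D y (Y y)) has_derivative (\<lambda>u. H x u (Y x) + D x (?Y' u))) (at x)"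
    by (simp only: D_expand[of _ "Y _"] D_expand[of _ "?Y' _"] H_expand[of _ _ "Y _"] sum.distrib)
  define \<gamma> where "\<gamma> t = retr c (x + t *\<^sub>R u)" for t :: real
  have \<gamma>: "(\<gamma> has_derivative (\<lambda>t. t *\<^sub>R u)) (at 0)" "\<gamma> 0 = x" "\<And>t. \<phi> (\<gamma> t) = c"
    using has_derivative_retr[OF x u] retr_fixed[OF x] retr_in_fibre by (simp_all add: \<gamma>_def[abs_def])
  have "smooth_on UNIV \<gamma>"
    unfolding \<gamma>_def by (intro smooth_on_affine_comp smooth_retr bounded_linear_scaleR_left) auto
  then have op: "open (\<gamma> -` U)"
    using U(1) smooth_on_continuous_on continuous_on_open_vimage open_UNIV
    by (metis Int_UNIV_right)
  have "((\<lambda>t. D (\<gamma> t) (Y (\<gamma> t))) has_derivative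
      (\<lambda>t. H x (t *\<^sub>R u) (Y x) + D x (?Y' (t *\<^sub>R u)))) (at 0)"
    by (rule has_derivative_compose[OF \<gamma>(1)]) (simp add: \<gamma>(2) K)
  moreover have "((\<lambda>t. D (\<gamma> t) (Y (\<gamma> t))) has_derivative (\<lambda>t. 0)) (at 0)"
    by (rule has_derivative_transform_within_open[where s = "\<gamma> -` U" and f = "\<lambda>t. 0"])
      (use op \<gamma> U tangent in auto)
  ultimately have "H x (1 *\<^sub>R u) (Y x) + D x (?Y' (1 *\<^sub>R u)) = 0"
    by (metis has_derivative_unique)
  then show ?thesis
    by (simp add: eq_neg_iff_add_eq_0 add.commute)
qed

lemma orthogonal_comp_kernel_eq_0:
  assumes "w \<in> orthogonal_comp {v. D x v = 0}" "D x w = 0" shows "w = 0"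
  using assms by (auto simp: orthogonal_comp_def orthogonal_def)

lemma D_orth_proj: "D x (orth_proj (orthogonal_comp {v. D x v = 0}) z) = D x z"
proof -
  obtain g h where D: "\<And>v. D x v = Complex (g \<bullet> v) (h \<bullet> v)"
    using D_Complex[where p = x] by metis
  let ?N = "orthogonal_comp {v. D x v = 0}"
  have "g \<in> ?N" "h \<in> ?N"
    by (auto simp: orthogonal_comp_def orthogonal_def D complex_eq_iff inner_commute)
  then have "g \<bullet> (z - orth_proj ?N z) = 0" "h \<bullet> (z - orth_proj ?N z) = 0"
    using orth_proj_exists(2)[OF subspace_orthogonal_comp] by (metis orthogonal_def inner_commute)+
  then have "g \<bullet> orth_proj ?N z = g \<bullet> z" "h \<bullet> orth_proj ?N z = h \<bullet> z"
    by (simp_all add: inner_diff_right)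
  then show ?thesis
    by (simp only: D)
qed

text \<open>The definite description has to be justified. Every admissible field yields a normal
  vector with the same image under \<open>D x\<close>, and \<open>D x\<close> is injective on the
  normal space, so at most one value occurs.\<close>

lemma second_fundamental_form_fibre:
  assumes x: "\<phi> x = c" and u: "D x u = 0" and v: "D x v = 0"
  defines "w \<equiv> second_fundamental_form {y. \<phi> y = c} x u v"
  shows "w \<in> orthogonal_comp {v. D x v = 0}" and "D x w = - H x u v"
proof -
  let ?N = "orthogonal_comp {v. D x v = 0}"
  let ?P = "\<lambda>w. \<exists>U Y. open U \<and> x \<in> U \<and> smooth_on U Y \<and>
        (\<forall>y\<in>{y. \<phi> y = c} \<inter> U. Y y \<in> tangent_space {y. \<phi> y = c} y) \<and> Y x = v \<and>
        w = orth_proj (orthogonal_comp (tangent_space {y. \<phi> y = c} x)) (frechet_derivative Y (at x) u)"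
  have P: "w \<in> ?N \<and> D x w = - H x u v" if "?P w" for w
  proof -
    obtain U Y where U: "open U" "x \<in> U" and Y: "smooth_on U Y" "Y x = v"
        "\<And>y. y \<in> U \<Longrightarrow> \<phi> y = c \<Longrightarrow> Y y \<in> tangent_space {y. \<phi> y = c} y"
      and w: "w = orth_proj ?N (frechet_derivative Y (at x) u)"
      using \<open>?P w\<close> unfolding tangent_space_fibre[OF x] by blast
    have "D y (Y y) = 0" if "y \<in> U" "\<phi> y = c" for y
      using Y(3)[OF that] tangent_space_fibre[OF that(2)] by simp
    then show ?thesis
      using derivative_tangent_field[OF x u U Y(1)] Y(2) orth_proj_exists(1)[OF subspace_orthogonal_comp]
      by (auto simp: w D_orth_proj)
  qed
  \<comment> \<open>An admissible field exists: the constant field \<open>v\<close>, projected at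
    each point onto the kernel of \<open>D y\<close> by means of the lift.\<close>
  define Y where "Y y = v - R y (D y v)" for y
  have "?P (orth_proj ?N (frechet_derivative Y (at x) u))"
  proof (intro exI[of _ UNIV] exI[of _ Y] conjI)
    show "smooth_on UNIV Y"
      unfolding Y_def
      by (intro smooth_on_diff smooth_on_const smooth_on_lift smooth_D open_UNIV)
    show "\<forall>y\<in>{y. \<phi> y = c} \<inter> UNIV. Y y \<in> tangent_space {y. \<phi> y = c} y"
      by (auto simp: tangent_space_fibre Y_def linear_diff[OF linear_D] D_lift)
    show "Y x = v"
      by (simp add: Y_def v linear_0[OF linear_lift])
  qed (auto simp: tangent_space_fibre[OF x])
  moreover have "w1 = w2" if "?P w1" "?P w2" for w1 w2
  proof -
    have "w1 - w2 \<in> ?N" "D x (w1 - w2) = 0"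
      using P[OF that(1)] P[OF that(2)] by (auto simp: subspace_diff[OF subspace_orthogonal_comp]
          linear_diff[OF linear_D])
    then show ?thesis
      using orthogonal_comp_kernel_eq_0 by fastforce
  qed
  ultimately have "\<exists>!w. ?P w"
    by (rule ex_ex1I[OF exI, where P = ?P])
  then have "?P w"
    unfolding w_def second_fundamental_form_def by (rule theI'[where P = ?P])
  then show "w \<in> ?N" "D x w = - H x u v"
    using P by blast+
qed

text \<open>This is the derivative of the isotropy of the gradient.\<close>

lemma hessian_gradient:
  assumes "\<And>v. D p v = Complex (g \<bullet> v) (h \<bullet> v)"
  shows "H p u g + \<i> * H p u h = 0"
proof -
  have "((\<lambda>q. \<Sum>b\<in>Basis. D q b * D q b) has_derivative
      (\<lambda>u. \<Sum>b\<in>Basis. D p b * H p u b + H p u b * D p b)) (at p)"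
    by (intro has_derivative_sum has_derivative_mult has_derivative_H)
  moreover have "((\<lambda>q. \<Sum>b\<in>Basis. D q b * D q b) has_derivative (\<lambda>u. 0)) (at p)"
    using isotropic_D by (simp add: power2_eq_square)
  ultimately have "(\<lambda>u. \<Sum>b\<in>Basis. D p b * H p u b + H p u b * D p b) = (\<lambda>u. 0)"
    by (rule has_derivative_unique)
  then have "(\<Sum>b\<in>Basis. H p u b * D p b) = 0"
    by (simp add: fun_eq_iff mult.commute mult_2[symmetric] sum_distrib_left[symmetric])
  moreover have "H p u g + \<i> * H p u h = (\<Sum>b\<in>Basis. H p u b * D p b)"
    unfolding H_expand[of p u g] H_expand[of p u h] sum_distrib_left sum.distrib[symmetric]
    by (rule sum.cong) (simp_all add: assms complex_eq_iff)
  ultimately show ?thesis by simp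
qed

text \<open>The derivative of isotropy, taken in the directions \<open>g\<close> and
  \<open>h\<close>, gives opposite values for \<open>H x g g\<close> and \<open>H x h h\<close>. So
  the trace over the tangent space equals the full trace, which is zero by harmonicity. The sum of
  the second fundamental forms is normal and killed by \<open>D x\<close>, hence zero.\<close>

lemma minimal_fibre: "minimal_submanifold {y. \<phi> y = c}"
  unfolding minimal_submanifold_def
proof (intro ballI allI impI)
  fix x B assume "x \<in> {y. \<phi> y = c}" and "orthonormal_basis (tangent_space {y. \<phi> y = c} x) B"
  then have x: "\<phi> x = c" and B: "orthonormal_basis {v. D x v = 0} B"
    by (auto simp: tangent_space_fibre)
  let ?N = "orthogonal_comp {v. D x v = 0}"
  let ?II = "\<lambda>b. second_fundamental_form {y. \<phi> y = c} x b b"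
  obtain g h r where D: "\<And>v. D x v = Complex (g \<bullet> v) (h \<bullet> v)" and gh: "g \<bullet> h = 0" "r > 0"
    "g \<bullet> g = r\<^sup>2" "h \<bullet> h = r\<^sup>2"
    using D_Complex[where p = x] by metis
  have "H x g g + \<i> * H x g h = 0" "H x h g + \<i> * H x h h = 0"
    using hessian_gradient[OF D] by auto
  then have "H x g g = - \<i> * H x g h" "H x h h = \<i> * H x g h"
    by (auto simp: H_commute[of x h g] complex_eq_iff)
  then have "(\<Sum>b\<in>B. H x b b) = 0"
    using trace_kernel_isotropic[OF gh B[unfolded D] linear_H_left linear_H_right, of x]
    by (simp add: trace_H)
  moreover have tangent: "D x b = 0" if "b \<in> B" for b
    using B span_base[OF that] by (auto simp: orthonormal_basis_def)
  ultimately have "D x (\<Sum>b\<in>B. ?II b) = 0"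
    using second_fundamental_form_fibre(2)[OF x] by (simp add: linear_sum[OF linear_D] sum_negf)
  moreover have "(\<Sum>b\<in>B. ?II b) \<in> ?N"
    using tangent by (intro subspace_sum[OF subspace_orthogonal_comp]
        second_fundamental_form_fibre(1)[OF x]) auto
  ultimately show "(1 / real (card B)) *\<^sub>R (\<Sum>b\<in>B. ?II b) = 0"
    using orthogonal_comp_kernel_eq_0 by simp
qed

section \<open>The foliation by fibres, its fullness and the Kaehler obstruction\<close>

definition fibres :: "'a set set" where
  "fibres = range (\<lambda>c. {y. \<phi> y = c})"

lemma fibre_nonempty: "{y. \<phi> y = c} \<noteq> {}"
  using retr_in_fibre by blast

text \<open>One chart covers everything: each fibre is connected and nonempty, hence is its own only
  plaque.\<close>

lemma foliation_submersion_fibres: "foliation_submersion UNIV fibres UNIV \<phi>"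
  unfolding foliation_submersion_def
proof (intro conjI ballI)
  fix L C assume "L \<in> fibres" "C \<in> components (L \<inter> UNIV)"
  then obtain c where L: "L = {y. \<phi> y = c}" "C \<in> components L"
    by (auto simp: fibres_def)
  moreover have "components L = {L}"
    using path_connected_fibre fibre_nonempty L(1)
    by (simp add: components_eq_sing_iff path_connected_imp_connected)
  ultimately show "\<exists>c. C = {x \<in> UNIV \<inter> UNIV. \<phi> x = c}" by auto
qed (use smooth surj_D in \<open>auto simp: D_def\<close>)

lemma foliation_fibres: "foliation_codim2 UNIV fibres"
  unfolding foliation_codim2_def partition_on_def
  using foliation_submersion_fibres path_connected_fibre fibre_nonempty
  by (auto simp: fibres_def disjoint_def)

lemma conformal_fibres: "conformal_foliation fibres"
  unfolding conformal_foliation_def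
  using foliation_submersion_fibres horizontally_conformal by blast

text \<open>If the leaves were preimages from a proper subspace \<open>A\<close>, then translation
  by a nonzero vector orthogonal to \<open>A\<close> would preserve each leaf, hence \<phi>.\<close>

lemma full_fibres:
  assumes "\<And>u. (\<And>x. \<phi> (x + u) = \<phi> x) \<Longrightarrow> u = 0"
  shows "full_foliation fibres"
  unfolding full_foliation_def
proof
  assume "\<exists>A F'. subspace A \<and> A \<noteq> UNIV \<and> foliation_codim2 A F' \<and> fibres = pullback_foliation A F'"
  then obtain A F' where A: "subspace A" "A \<noteq> UNIV" and F: "fibres = pullback_foliation A F'"
    by blast
  then obtain z where "z \<notin> A" by blast
  define u where "u = z - orth_proj A z"
  have u: "u \<noteq> 0" "\<And>a. a \<in> A \<Longrightarrow> u \<bullet> a = 0"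
    using orth_proj_exists[OF A(1), where x = z] \<open>z \<notin> A\<close> by (auto simp: u_def orthogonal_def)
  have "orth_proj A (x + u) = orth_proj A x" for x
  proof -
    have "orthogonal (x + u - y) a = orthogonal (x - y) a" if "a \<in> A" for y a
      using u(2)[OF that] by (simp add: orthogonal_def inner_left_distrib inner_diff_left)
    then show ?thesis
      unfolding orth_proj_def by (metis (no_types, lifting))
  qed
  moreover have "\<exists>L. {y. \<phi> y = \<phi> x} = orth_proj A -` L" for x
  proof -
    have "{y. \<phi> y = \<phi> x} \<in> pullback_foliation A F'"
      unfolding F[symmetric] fibres_def by (rule rangeI)
    then show ?thesis
      unfolding pullback_foliation_def by blast
  qed
  ultimately have "x + u \<in> {y. \<phi> y = \<phi> x}" for x
    by (metis (mono_tags, lifting) mem_Collect_eq vimage_eq)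
  then show False
    using assms u(1) by simp
qed

text \<open>The cases of even and odd dimension are \<open>\<pi> = id\<close> and \<open>\<pi> = fst\<close>.  Isotropic gradients of
  the same type with respect to \<open>J\<close> are orthogonal, and two of three points have gradients
  of the same type.\<close>

lemma not_kaehler_type:
  fixes \<pi> :: "'b::euclidean_space \<Rightarrow> 'a"
  assumes \<pi>: "linear \<pi>" "surj \<pi>"
    and trace: "\<And>E E' :: 'a \<Rightarrow> complex. linear E \<Longrightarrow> linear E' \<Longrightarrow>
      (\<Sum>b\<in>Basis. E (\<pi> b) * E' (\<pi> b)) = (\<Sum>b\<in>Basis. E b * E' b)"
    and J: "kaehler_structure J"
    and \<psi>: "\<And>x. \<psi> differentiable (at x)"
      "\<And>x v. frechet_derivative \<psi> (at x) (\<pi> (J v)) = \<i> * frechet_derivative \<psi> (at x) (\<pi> v)"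
    and const: "\<And>x y. \<phi> x = \<phi> y \<Longrightarrow> \<psi> x = \<psi> y"
    and conn: "\<And>S x y c. connected S \<Longrightarrow> (\<And>z. z \<in> S \<Longrightarrow> \<psi> z = c) \<Longrightarrow> x \<in> S \<Longrightarrow> y \<in> S \<Longrightarrow> \<phi> x = \<phi> y"
    and pts: "(\<Sum>b\<in>Basis. D p b * D q b) \<noteq> 0" "(\<Sum>b\<in>Basis. D q b * D s b) \<noteq> 0"
      "(\<Sum>b\<in>Basis. D p b * D s b) \<noteq> 0"
  shows False
proof -
  let ?d = "\<lambda>x. frechet_derivative \<psi> (at x)"
  have d: "(\<psi> has_derivative ?d x) (at x)" for x
    using \<psi>(1) frechet_derivative_works by blast
  define of_type where "of_type \<sigma> = {x. \<forall>v. D x (\<pi> (J v)) = \<sigma> * D x (\<pi> v)}" for \<sigma>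
  have cont: "continuous_on UNIV (\<lambda>x. D x v)" for v
    using smooth_on_continuous_on[OF smooth_D] .
  have "closed (of_type \<sigma>)" for \<sigma>
    unfolding of_type_def by (intro closed_Collect_all closed_Collect_eq continuous_intros cont)
  then have "closed (of_type \<i> \<union> of_type (-\<i>))" by blast
  have lin: "linear (\<lambda>v. D x (\<pi> v))" for x
    using linear_compose[OF \<pi>(1) linear_D] by (simp add: o_def)
  \<comment> \<open>Since \<psi> is constant on the fibres, moving along a retracted line shows that
    its differential vanishes on the kernel of \<open>D x\<close>. If it is not zero, the comparison
    of isotropic functionals applies and gives the type of \<open>x\<close>.\<close>
  have regular: "x \<in> of_type \<i> \<union> of_type (-\<i>)" if "?d x v \<noteq> 0" for x v
  proof -
    obtain u where u: "v = \<pi> u"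
      using \<pi>(2) by blast
    have "?d x v = 0" if v: "D x v = 0" for v
    proof -
      have "((\<lambda>t. \<psi> (retr (\<phi> x) (x + t *\<^sub>R v))) has_derivative (\<lambda>t. ?d x (t *\<^sub>R v))) (at 0)"
        by (rule has_derivative_compose[OF has_derivative_retr[OF refl v]]) (simp add: retr_fixed d)
      moreover have "((\<lambda>t. \<psi> (retr (\<phi> x) (x + t *\<^sub>R v))) has_derivative (\<lambda>t. 0)) (at 0)"
        using const[OF retr_in_fibre[of "\<phi> x"]] by simp
      ultimately have "?d x (1 *\<^sub>R v) = 0"
        by (metis has_derivative_unique)
      then show ?thesis by simp
    qed
    moreover have "linear (\<lambda>v. ?d x (\<pi> v))"
      using linear_compose[OF \<pi>(1) has_derivative_linear[OF d]] by (simp add: o_def)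
    moreover have "surj (\<lambda>v. D x (\<pi> v))"
      using comp_surj[OF \<pi>(2) surj_D] by (simp add: o_def)
    moreover have "(\<Sum>b\<in>Basis. (D x (\<pi> b))\<^sup>2) = 0"
      using trace[OF linear_D linear_D, of x x] isotropic_D[of x] by (simp add: power2_eq_square)
    ultimately show ?thesis
      using isotropic_holomorphic_or_antiholomorphic[OF J lin[of x], of "\<lambda>v. ?d x (\<pi> v)" u]
        \<psi>(2) that u by (auto simp: of_type_def)
  qed
  \<comment> \<open>A point of neither type has a ball of such points around it. There the
    differential of \<psi> vanishes, so \<psi> is constant and the connected ball lies in one fibre,
    although \<phi> is a submersion.\<close>
  have types: "x \<in> of_type \<i> \<or> x \<in> of_type (-\<i>)" for x
  proof (rule ccontr)
    assume "\<not> (x \<in> of_type \<i> \<or> x \<in> of_type (-\<i>))"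
    then have "x \<in> - (of_type \<i> \<union> of_type (-\<i>))" by blast
    then obtain e where "e > 0" and sub: "ball x e \<subseteq> - (of_type \<i> \<union> of_type (-\<i>))"
      using \<open>closed (of_type \<i> \<union> of_type (-\<i>))\<close> unfolding closed_open open_contains_ball by metis
    have e: "y \<notin> of_type \<i> \<union> of_type (-\<i>)" if "y \<in> ball x e" for y
      using sub that by blast
    have "?d y = (\<lambda>v. 0)" if "y \<in> ball x e" for y
      using regular e that by blast
    then obtain c where "\<And>y. y \<in> ball x e \<Longrightarrow> \<psi> y = c"
      using has_derivative_zero_constant[OF convex_ball, of x e \<psi>] d has_derivative_at_withinI
      by metis
    then have eq: "\<phi> y = \<phi> x" if "y \<in> ball x e" for y
      using conn[OF connected_ball] that \<open>e > 0\<close> by (metis centre_in_ball)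
    have "(\<phi> has_derivative (\<lambda>v. 0)) (at x)"
      by (rule has_derivative_transform_within_open[where s = "ball x e" and f = "\<lambda>y. \<phi> x"])
        (use \<open>e > 0\<close> in \<open>auto intro: eq[symmetric]\<close>)
    then have "D x (R x 1) = 0"
      using has_derivative_D has_derivative_unique by metis
    then show False
      by (simp add: D_lift)
  qed
  have "(\<Sum>b\<in>Basis. D x b * D y b) = 0" if "x \<in> of_type \<sigma>" "y \<in> of_type \<sigma>" "\<sigma>\<^sup>2 = -1" for x y \<sigma>
    using kaehler_structure_trace_zero[OF J lin lin, of x \<sigma> y] that
      trace[OF linear_D linear_D, of x y] by (simp add: of_type_def)
  \<comment> \<open>Membership in \<open>of_type \<i>\<close> alone classifies the points, because
    its complement is contained in \<open>of_type (-\<i>)\<close>.\<close>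
  then have "(\<Sum>b\<in>Basis. D x b * D y b) = 0" if "x \<in> of_type \<i> \<longleftrightarrow> y \<in> of_type \<i>" for x y
    using that types[of x] types[of y] by (cases "x \<in> of_type \<i>") (metis power2_i power2_minus)+
  then show False
    using pts by metis
qed

text \<open>Equality of the two sets of leaves is used in three ways: the leaves cover the space, so
  \<open>U\<close> is everything; each fibre lies in a level set of \<psi>; and a connected part of
  such a level set lies in a single fibre.\<close>

lemma not_from_kaehler_fibres:
  assumes pts: "(\<Sum>b\<in>Basis. D p b * D q b) \<noteq> 0" "(\<Sum>b\<in>Basis. D q b * D s b) \<noteq> 0"
      "(\<Sum>b\<in>Basis. D p b * D s b) \<noteq> 0"
  shows "\<not> foliation_from_kaehler fibres"
proof
  assume "foliation_from_kaehler fibres"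
  then obtain U \<psi> where map: "map_from_kaehler U \<psi>"
    and F: "fibres = {C. \<exists>c. C \<in> components {x \<in> U. \<psi> x = c}}"
    unfolding foliation_from_kaehler_def by blast
  have leaf: "\<exists>c. {y. \<phi> y = \<phi> x} \<subseteq> {y \<in> U. \<psi> y = c}" for x
  proof -
    have "{y. \<phi> y = \<phi> x} \<in> fibres"
      by (simp add: fibres_def)
    then show ?thesis
      unfolding F using in_components_subset by blast
  qed
  have U: "U = UNIV"
    using leaf by blast
  have const: "\<psi> x = \<psi> y" if "\<phi> x = \<phi> y" for x y
    using leaf[of x] that by (auto simp: subset_iff)
  have conn: "\<phi> x = \<phi> y" if S: "connected S" "\<And>z. z \<in> S \<Longrightarrow> \<psi> z = c" "x \<in> S" "y \<in> S"
    for S x y c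
  proof -
    have "S \<subseteq> {x \<in> U. \<psi> x = c}" using S U by auto
    then obtain C where "C \<in> components {x \<in> U. \<psi> x = c}" "S \<subseteq> C"
      using exists_component_superset[OF _ _ S(1)] S(3) by blast
    then have "C \<in> fibres" unfolding F by blast
    with \<open>S \<subseteq> C\<close> S(3,4) show ?thesis
      by (auto simp: fibres_def)
  qed
  from map consider
      (even) J where "kaehler_structure J" "kaehler_holomorphic_on J U \<psi>"
    | (odd) J W where "open W" "fst ` W = U" "kaehler_structure (J :: 'a \<times> real \<Rightarrow> _)"
        "kaehler_holomorphic_on J W (\<psi> \<circ> fst)"
    unfolding map_from_kaehler_def by blast
  then show False
  proof cases
    case even
    then show False
      using even(2) unfolding U kaehler_holomorphic_on_def
      by (intro not_kaehler_type[where \<pi> = "\<lambda>x. x" and \<psi> = \<psi>, OF linear_ident surj_id[unfolded id_def]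
            _ even(1) _ _ const conn pts]) simp_all
  next
    case odd
    have der: "\<psi> differentiable (at x) \<and>
        frechet_derivative \<psi> (at x) (fst (J v)) = \<i> * frechet_derivative \<psi> (at x) (fst v)" for x v
    proof -
      \<comment> \<open>Any height over \<open>x\<close> inside \<open>W\<close> will do: the slice
        at height \<open>t\<close> transfers differentiability and holomorphicity from \<psi>
        composed with \<open>fst\<close> to \<psi>.\<close>
      obtain t where "(x, t) \<in> W"
        using odd(2) U by force
      then have hol: "(\<psi> \<circ> fst) differentiable (at (x, t))"
        "frechet_derivative (\<psi> \<circ> fst) (at (x, t)) (J v) =
          \<i> * frechet_derivative (\<psi> \<circ> fst) (at (x, t)) v"
        using odd(4) unfolding kaehler_holomorphic_on_def by blast+
      have "((\<lambda>y. (y, t)) has_derivative (\<lambda>v. (v, 0))) (at x)"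
        by (intro has_derivative_Pair has_derivative_ident has_derivative_const)
      then have "(\<lambda>y. (\<psi> \<circ> fst) (y, t)) differentiable (at x)"
        using hol(1) has_derivative_compose unfolding differentiable_def by blast
      then have diff: "\<psi> differentiable (at x)" by simp
      then have "(\<psi> has_derivative frechet_derivative \<psi> (at x)) (at (fst (x, t)))"
        by (simp add: frechet_derivative_works)
      then have "((\<lambda>y. \<psi> (fst y)) has_derivative (\<lambda>v. frechet_derivative \<psi> (at x) (fst v))) (at (x, t))"
        using has_derivative_compose[OF bounded_linear_imp_has_derivative[OF bounded_linear_fst]]
        by blast
      then have "frechet_derivative (\<psi> \<circ> fst) (at (x, t)) =
          (\<lambda>v. frechet_derivative \<psi> (at x) (fst v))"
        using frechet_derivative_at by (fastforce simp: o_def)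
      with diff hol(2) show ?thesis by simp
    qed
    \<comment> \<open>The additional basis vector of the product projects to 0 and contributes
      nothing to the trace.\<close>
    have "(\<Sum>b\<in>Basis. E (fst b) * E' (fst b)) = (\<Sum>b\<in>Basis. E b * E' b)"
      if "linear E" for E E' :: "'a \<Rightarrow> complex"
      unfolding Basis_prod_def
      by (subst sum.union_disjoint) (auto simp: sum.reindex inj_on_def linear_0[OF that])
    moreover have "surj (fst :: 'a \<times> real \<Rightarrow> 'a)"
      by (rule surjI[where f = "\<lambda>x. (x, 0)"]) simp
    ultimately show False
      using der
      by (intro not_kaehler_type[where \<pi> = fst and \<psi> = \<psi>, OF linear_fst _
            _ odd(3) _ _ const conn pts]) simp_all
  qed
qed

end

section \<open>Null curves\<close>

lemma sum_Basis_vec: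
  fixes f :: "real ^ 'n \<Rightarrow> 'b::comm_monoid_add"
  shows "(\<Sum>b\<in>Basis. f b) = (\<Sum>i\<in>UNIV. f (axis i 1))"
proof -
  have "(Basis :: (real^'n) set) = range (\<lambda>i. axis i 1)"
    by (auto simp: Basis_vec_def)
  moreover have "inj (\<lambda>i :: 'n. axis i (1 :: real))"
    by (simp add: inj_on_def axis_eq_axis)
  ultimately show ?thesis
    by (metis (no_types, lifting) comp_apply sum.cong sum.reindex)
qed

lemma smooth_on_vec:
  fixes f :: "'a::real_normed_vector \<Rightarrow> real ^ 'n"
  assumes "open S" "\<And>i. smooth_on S (\<lambda>x. f x $ i)"
  shows "smooth_on S f"
proof -
  have eq: "(\<lambda>x. \<Sum>i\<in>UNIV. f x $ i *\<^sub>R axis i 1) = f"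
    using basis_expansion[of "f _"] by (simp add: scalar_mult_eq_scaleR)
  have "smooth_on S (\<lambda>x. \<Sum>i\<in>UNIV. f x $ i *\<^sub>R (axis i 1 :: real ^ 'n))"
    by (intro smooth_on_sum assms smooth_on_linear_comp[OF bounded_linear_scaleR_left])
  then show ?thesis unfolding eq .
qed

text \<open>A null curve \<open>\<xi>\<close> in the complexification of the orthogonal complement of the plane of the
  coordinates \<open>a\<close> and \<open>b\<close>.\<close>

locale null_curve =
  fixes a b :: "'n::finite" and \<xi> :: "'n \<Rightarrow> complex poly"
  assumes distinct: "a \<noteq> b" and \<xi>_ab: "\<xi> a = 0" "\<xi> b = 0"
    and null: "(\<Sum>i\<in>UNIV. (poly (\<xi> i) w)\<^sup>2) = 0"
    and nonzero: "\<exists>i. poly (\<xi> i) w \<noteq> 0"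
begin

definition \<zeta> :: "real ^ 'n \<Rightarrow> complex" where
  "\<zeta> x = Complex (x $ a) (x $ b)"

definition \<phi> :: "real ^ 'n \<Rightarrow> complex" where
  "\<phi> x = (\<Sum>i\<in>UNIV. x $ i *\<^sub>R poly (\<xi> i) (\<zeta> x))"

definition N :: "real ^ 'n \<Rightarrow> real" where
  "N x = (\<Sum>i\<in>UNIV. (cmod (poly (\<xi> i) (\<zeta> x)))\<^sup>2)"

text \<open>Pairing the real vector 2 Re (w cnj \<xi>) with \<xi> gives w |\<xi>|^2 + cnj w
  (\<Sum>\<xi>_i^2), and nullity removes the second term; hence the division by \<open>N\<close>.
  The components \<open>a\<close> and \<open>b\<close> vanish, so \<zeta> stays fixed and \<phi> is
  affine along the lift.\<close>

definition R :: "real ^ 'n \<Rightarrow> complex \<Rightarrow> real ^ 'n" where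
  "R x w = (\<chi> i. 2 * Re (w * cnj (poly (\<xi> i) (\<zeta> x))) * inverse (N x))"

section \<open>Derivatives of \<phi>, isotropy and harmonicity\<close>

lemma linear_\<zeta>: "linear \<zeta>"
  by (rule linearI) (simp_all add: \<zeta>_def complex_eq_iff)

lemma bounded_linear_\<zeta>: "bounded_linear \<zeta>"
  using linear_\<zeta> linear_conv_bounded_linear by blast

lemma has_derivative_poly_\<zeta>:
  "((\<lambda>x. poly q (\<zeta> x)) has_derivative (\<lambda>v. poly (pderiv q) (\<zeta> x) * \<zeta> v)) (at x)"
  by (rule has_derivative_compose[OF bounded_linear_imp_has_derivative[OF bounded_linear_\<zeta>]
        poly_DERIV[unfolded has_field_derivative_def]])

lemma has_derivative_nth: "((\<lambda>x. x $ i) has_derivative (\<lambda>v. v $ i)) (at x)"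
  by (rule bounded_linear_imp_has_derivative[OF bounded_linear_vec_nth])

lemma has_derivative_\<phi>:
  "(\<phi> has_derivative (\<lambda>v. \<Sum>i\<in>UNIV. x $ i *\<^sub>R (poly (pderiv (\<xi> i)) (\<zeta> x) * \<zeta> v)
     + v $ i *\<^sub>R poly (\<xi> i) (\<zeta> x))) (at x)"
  unfolding \<phi>_def
  by (intro has_derivative_sum has_derivative_scaleR has_derivative_nth has_derivative_poly_\<zeta>)

lemma frechet_derivative_\<phi>:
  "frechet_derivative \<phi> (at x) v = (\<Sum>i\<in>UNIV. x $ i *\<^sub>R (poly (pderiv (\<xi> i)) (\<zeta> x) * \<zeta> v)
     + v $ i *\<^sub>R poly (\<xi> i) (\<zeta> x))"
  by (rule fun_cong[OF frechet_derivative_at[OF has_derivative_\<phi>], symmetric])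

lemma hessian_\<phi>:
  "frechet_derivative (\<lambda>y. frechet_derivative \<phi> (at y) v) (at x) u =
   (\<Sum>i\<in>UNIV. x $ i *\<^sub>R (poly (pderiv (pderiv (\<xi> i))) (\<zeta> x) * \<zeta> u * \<zeta> v)
     + u $ i *\<^sub>R (poly (pderiv (\<xi> i)) (\<zeta> x) * \<zeta> v)
     + v $ i *\<^sub>R (poly (pderiv (\<xi> i)) (\<zeta> x) * \<zeta> u))"
proof -
  have "((\<lambda>y. \<Sum>i\<in>UNIV. y $ i *\<^sub>R (poly (pderiv (\<xi> i)) (\<zeta> y) * \<zeta> v)
     + v $ i *\<^sub>R poly (\<xi> i) (\<zeta> y)) has_derivative
    (\<lambda>u. \<Sum>i\<in>UNIV. (x $ i *\<^sub>R (poly (pderiv (pderiv (\<xi> i))) (\<zeta> x) * \<zeta> u * \<zeta> v)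
     + u $ i *\<^sub>R (poly (pderiv (\<xi> i)) (\<zeta> x) * \<zeta> v))
     + v $ i *\<^sub>R (poly (pderiv (\<xi> i)) (\<zeta> x) * \<zeta> u))) (at x)"
    by (intro has_derivative_sum has_derivative_add has_derivative_scaleR has_derivative_nth
        has_derivative_mult_left has_derivative_scaleR_right has_derivative_poly_\<zeta>)
  from fun_cong[OF frechet_derivative_at[OF this], of u] show ?thesis
    unfolding frechet_derivative_\<phi> by simp
qed

lemma \<zeta>_axis: "\<zeta> (axis i t) = (if i = a then of_real t else if i = b then \<i> * of_real t else 0)"
  using distinct by (auto simp: \<zeta>_def axis_def complex_eq_iff)

lemma sum_\<zeta>_axis:
  "(\<Sum>i\<in>UNIV. \<zeta> (axis i 1) * f i) = f a + \<i> * f b"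
proof -
  have "(\<Sum>i\<in>UNIV. \<zeta> (axis i 1) * f i) = (\<Sum>i\<in>{a, b}. \<zeta> (axis i 1) * f i)"
    by (rule sum.mono_neutral_right) (auto simp: \<zeta>_axis)
  then show ?thesis
    using distinct by (simp add: \<zeta>_axis)
qed

lemma sum_axis:
  fixes f :: "'n \<Rightarrow> complex"
  shows "(\<Sum>i\<in>UNIV. axis j t $ i *\<^sub>R f i) = t *\<^sub>R f j"
proof -
  have "axis j t $ i *\<^sub>R f i = (if i = j then t *\<^sub>R f j else 0)" for i
    by (simp add: axis_def)
  then show ?thesis by simp
qed

text \<open>The gradient is \<xi> plus a multiple of the gradient of \<zeta>, which has the entries
  1 and \<i> at \<open>a\<close> and \<open>b\<close>. The latter is isotropic, and orthogonal to
  \<xi> because \<xi> vanishes at \<open>a\<close> and \<open>b\<close>, so only the product of the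
  two values of \<xi> remains.\<close>

lemma gradient_product:
  "(\<Sum>e\<in>Basis. frechet_derivative \<phi> (at x) e * frechet_derivative \<phi> (at y) e) =
   (\<Sum>i\<in>UNIV. poly (\<xi> i) (\<zeta> x) * poly (\<xi> i) (\<zeta> y))"
proof -
  define \<Psi> where "\<Psi> x = (\<Sum>i\<in>UNIV. x $ i *\<^sub>R poly (pderiv (\<xi> i)) (\<zeta> x))" for x
  have "frechet_derivative \<phi> (at x) (axis j 1) = \<zeta> (axis j 1) * \<Psi> x + poly (\<xi> j) (\<zeta> x)" for x j
    unfolding frechet_derivative_\<phi> sum.distrib sum_axis \<Psi>_def by (simp add: sum_distrib_left mult.commute)
  then have "(\<Sum>e\<in>Basis. frechet_derivative \<phi> (at x) e * frechet_derivative \<phi> (at y) e) =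
      (\<Sum>j\<in>UNIV. \<zeta> (axis j 1) * (\<zeta> (axis j 1) * (\<Psi> x * \<Psi> y))
        + \<zeta> (axis j 1) * (\<Psi> x * poly (\<xi> j) (\<zeta> y) + \<Psi> y * poly (\<xi> j) (\<zeta> x))
        + poly (\<xi> j) (\<zeta> x) * poly (\<xi> j) (\<zeta> y))"
    by (simp add: sum_Basis_vec algebra_simps)
  also have "\<dots> = (\<Sum>i\<in>UNIV. poly (\<xi> i) (\<zeta> x) * poly (\<xi> i) (\<zeta> y))"
    unfolding sum.distrib sum_\<zeta>_axis using distinct by (simp add: \<zeta>_axis \<xi>_ab)
  finally show ?thesis .
qed

text \<open>Since \<phi> is holomorphic in \<zeta>, the second derivatives in the directions
  \<open>a\<close> and \<open>b\<close> cancel; the mixed terms contain only the zero polynomials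
  \<open>\<xi> a\<close> and \<open>\<xi> b\<close>.\<close>

lemma laplacian_\<phi>:
  "(\<Sum>e\<in>Basis. frechet_derivative (\<lambda>y. frechet_derivative \<phi> (at y) e) (at x) e) = 0"
proof -
  define \<Psi> where "\<Psi> = (\<Sum>i\<in>UNIV. x $ i *\<^sub>R poly (pderiv (pderiv (\<xi> i))) (\<zeta> x))"
  have "frechet_derivative (\<lambda>y. frechet_derivative \<phi> (at y) (axis j 1)) (at x) (axis j 1) =
      \<zeta> (axis j 1) * (\<zeta> (axis j 1) * \<Psi> + 2 * poly (pderiv (\<xi> j)) (\<zeta> x))" for j
    unfolding hessian_\<phi> sum.distrib sum_axis \<Psi>_def
    by (simp add: sum_distrib_left algebra_simps)
  then show ?thesis
    using distinct by (simp add: sum_Basis_vec sum_\<zeta>_axis) (simp add: \<zeta>_axis \<xi>_ab algebra_simps)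
qed

lemma N_pos: "N x > 0"
proof -
  obtain i where "poly (\<xi> i) (\<zeta> x) \<noteq> 0" using nonzero by blast
  then show ?thesis
    unfolding N_def by (intro sum_pos2[where i = i]) auto
qed

lemma \<zeta>_lift: "\<zeta> (R x w) = 0"
  by (simp add: \<zeta>_def R_def \<xi>_ab complex_eq_iff)

lemma \<phi>_lift: "\<phi> (x + R x w) = \<phi> x + w"
proof -
  have "\<zeta> (x + R x w) = \<zeta> x"
    by (simp add: linear_add[OF linear_\<zeta>] \<zeta>_lift)
  then have "\<phi> (x + R x w) = \<phi> x + (\<Sum>i\<in>UNIV. R x w $ i *\<^sub>R poly (\<xi> i) (\<zeta> x))"
    by (simp add: \<phi>_def scaleR_add_left sum.distrib)
  also have "(\<Sum>i\<in>UNIV. R x w $ i *\<^sub>R poly (\<xi> i) (\<zeta> x)) =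
      (\<Sum>i\<in>UNIV. of_real (inverse (N x)) *
        (w * of_real ((cmod (poly (\<xi> i) (\<zeta> x)))\<^sup>2) + cnj w * (poly (\<xi> i) (\<zeta> x))\<^sup>2))"
  proof (rule sum.cong)
    fix i
    let ?q = "poly (\<xi> i) (\<zeta> x)"
    have "R x w $ i *\<^sub>R ?q = of_real (inverse (N x)) * (of_real (2 * Re (w * cnj ?q)) * ?q)"
      by (simp add: R_def scaleR_conv_of_real)
    also have "of_real (2 * Re (w * cnj ?q)) = w * cnj ?q + cnj w * ?q"
      using complex_add_cnj[of "w * cnj ?q"] by (simp del: of_real_mult)
    also have "\<dots> * ?q = w * (?q * cnj ?q) + cnj w * ?q\<^sup>2"
      by (simp add: power2_eq_square algebra_simps)
    finally show "R x w $ i *\<^sub>R ?q = of_real (inverse (N x)) *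
        (w * of_real ((cmod ?q)\<^sup>2) + cnj w * ?q\<^sup>2)"
      by (simp only: complex_norm_square)
  qed simp
  also have "\<dots> = of_real (inverse (N x)) * (w * of_real (N x) + cnj w * (\<Sum>i\<in>UNIV. (poly (\<xi> i) (\<zeta> x))\<^sup>2))"
    by (simp only: N_def of_real_sum sum_distrib_left[symmetric] sum.distrib)
  also have "\<dots> = w"
    using N_pos[of x] by (simp add: null)
  finally show ?thesis .
qed

lemma smooth_poly_\<zeta>: "smooth_on UNIV (\<lambda>x. poly q (\<zeta> x))"
  by (intro smooth_on_poly smooth_on_linear bounded_linear_\<zeta> open_UNIV)

lemma smooth_\<phi>: "smooth_on UNIV \<phi>"
  unfolding \<phi>_def[abs_def]
  by (intro smooth_on_sum smooth_on_bilinear[OF _ bounded_bilinear_scaleR] smooth_poly_\<zeta>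
      smooth_on_linear bounded_linear_vec_nth open_UNIV)

lemma smooth_R: "smooth_on UNIV (\<lambda>x. R x w)"
proof (rule smooth_on_vec[OF open_UNIV])
  fix i
  have N: "N = (\<lambda>x. \<Sum>i\<in>UNIV. Re (poly (\<xi> i) (\<zeta> x) * cnj (poly (\<xi> i) (\<zeta> x))))"
    by (simp add: N_def fun_eq_iff cmod_power2) (simp add: power2_eq_square)
  have cnj: "smooth_on UNIV (\<lambda>x. cnj (poly (\<xi> i) (\<zeta> x)))" for i
    by (intro smooth_on_linear_comp[OF bounded_linear_cnj] smooth_poly_\<zeta> open_UNIV)
  have "smooth_on UNIV N"
    unfolding N
    by (intro smooth_on_sum smooth_on_linear_comp[OF bounded_linear_Re]
        smooth_on_bilinear[OF _ bounded_bilinear_mult] cnj smooth_poly_\<zeta> open_UNIV)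
  then show "smooth_on UNIV (\<lambda>x. R x w $ i)"
    unfolding R_def vec_lambda_beta using N_pos
    by (intro smooth_on_bilinear[OF _ bounded_bilinear_mult] smooth_on_const cnj
        smooth_on_linear_comp[OF bounded_linear_Re] smooth_on_inverse open_UNIV)
      (simp_all add: less_imp_neq[symmetric])
qed

lemma hessian_\<phi>_commute:
  "frechet_derivative (\<lambda>q. frechet_derivative \<phi> (at q) v) (at x) u =
   frechet_derivative (\<lambda>q. frechet_derivative \<phi> (at q) u) (at x) v"
  unfolding hessian_\<phi> by (rule sum.cong) (simp_all add: algebra_simps)

sublocale lifted_harmonic_morphism \<phi> R
proof (rule lifted_harmonic_morphism.intro)
  show "(\<Sum>e\<in>Basis. (frechet_derivative \<phi> (at x) e)\<^sup>2) = 0" for x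
    using gradient_product[of x x] null by (simp add: power2_eq_square)
  show "linear (R x)" for x
    by (rule linearI) (simp_all add: R_def vec_eq_iff algebra_simps)
qed (rule smooth_\<phi> laplacian_\<phi> hessian_\<phi>_commute smooth_R \<phi>_lift)+

text \<open>Points of the plane of \<open>a\<close> and \<open>b\<close> detect the components of a
  translation outside this plane, by independence. A translation within the plane shifts \<zeta> and
  is detected by \<open>\<xi> j\<close>, whose only zero is 0.\<close>

lemma full_null_curve:
  assumes indep: "\<And>(t :: 'n \<Rightarrow> real) i. (\<And>w. (\<Sum>i\<in>UNIV. t i *\<^sub>R poly (\<xi> i) w) = 0) \<Longrightarrow>
      i \<noteq> a \<Longrightarrow> i \<noteq> b \<Longrightarrow> t i = 0"
    and j: "\<And>w. poly (\<xi> j) w = 0 \<longleftrightarrow> w = 0"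
  shows "full_foliation fibres"
proof (rule full_fibres)
  fix u assume u: "\<And>x. \<phi> (x + u) = \<phi> x"
  have plane: "(\<Sum>i\<in>UNIV. (axis a s + axis b t + v) $ i *\<^sub>R poly (\<xi> i) w) =
      (\<Sum>i\<in>UNIV. v $ i *\<^sub>R poly (\<xi> i) w)" for s t v w
    by (simp add: scaleR_add_left sum.distrib sum_axis \<xi>_ab)
  have "(\<Sum>i\<in>UNIV. u $ i *\<^sub>R poly (\<xi> i) w) = 0" for w
  proof -
    \<comment> \<open>The point of the plane for which \<open>?x + u\<close> has the coordinate
      \<open>w\<close>; \<phi> vanishes at \<open>?x\<close>, as all its other components are
      0.\<close>
    let ?x = "axis a (Re (w - \<zeta> u)) + axis b (Im (w - \<zeta> u))"
    have "\<zeta> ?x = w - \<zeta> u"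
      using distinct by (simp add: linear_add[OF linear_\<zeta>] \<zeta>_axis complex_eq_iff)
    then have "\<phi> (?x + u) = (\<Sum>i\<in>UNIV. u $ i *\<^sub>R poly (\<xi> i) w)"
      unfolding \<phi>_def plane by (simp add: linear_add[OF linear_\<zeta>])
    moreover have "\<phi> ?x = 0"
      using plane[of _ _ 0] by (simp add: \<phi>_def)
    ultimately show ?thesis using u by simp
  qed
  note zero = this
  then have u0: "u $ i = 0" if "i \<noteq> a" "i \<noteq> b" for i
    using indep[of "\<lambda>i. u $ i"] that by blast
  have "j \<noteq> a" "j \<noteq> b"
    using j[of 1] \<xi>_ab by auto
  then have "\<phi> (axis j 1 + u) = poly (\<xi> j) (\<zeta> u)" "\<phi> (axis j 1) = poly (\<xi> j) 0"
    using \<open>j \<noteq> a\<close> \<open>j \<noteq> b\<close>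
    by (simp_all add: \<phi>_def scaleR_add_left sum.distrib sum_axis zero linear_add[OF linear_\<zeta>] \<zeta>_axis)
  then have "\<zeta> u = 0"
    using u[of "axis j 1"] j by metis
  then have "u $ i = 0" for i
    using u0[of i] by (cases "i = a \<or> i = b") (auto simp: \<zeta>_def complex_eq_iff)
  then show "u = 0" by (simp add: vec_eq_iff)
qed

end

text \<open>With \<open>P w = w\<^sup>2 + w\<^sup>4 + \<dots>\<close> the curve \<open>(1 - P, \<i> (1 + P), 2 w, 2 w\<^sup>2, \<dots>)\<close> is null, and
  the complex inner product of its values at \<open>w\<close> and \<open>w'\<close> is \<open>-2 (\<Sum>\<^sub>k (w\<^sup>k - w'\<^sup>k)\<^sup>2)\<close>.\<close>

theorem corollary4p22:
  assumes "CARD('n::finite) > 4"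
  shows "\<exists>F :: (real ^ 'n) set set.
    foliation_codim2 UNIV F \<and>
    conformal_foliation F \<and>
    full_foliation F \<and>
    (\<forall>L\<in>F. minimal_submanifold L) \<and>
    \<not> foliation_from_kaehler F"
proof -
  obtain f :: "'n \<Rightarrow> nat" where f: "bij_betw f UNIV {0..<CARD('n)}"
    using ex_bij_betw_finite_nat[of "UNIV :: 'n set"] by auto
  then have inj: "inj f"
    by (simp add: bij_betw_def)
  have "\<exists>i. f i = k" if "k \<le> 4" for k
    using f that assms by (metis bij_betw_iff_bijections atLeastLessThan_iff le0 le_less_trans)
  \<comment> \<open>The roles are: \<open>a\<close> and \<open>b\<close> span the plane of \<zeta>,
    \<open>c\<close> and \<open>d\<close> carry 1 - P and \<i> (1 + P), and the fifth index
    \<open>j\<close> carries 2 w.\<close>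
  from this[of 0] this[of 1] this[of 2] this[of 3] this[of 4]
  obtain a b c d j where fi: "f a = 0" "f b = 1" "f c = 2" "f d = 3" "f j = 4"
    by auto
  define I where "I = {i. f i > 3}"
  \<comment> \<open>The offset makes the exponents on \<open>I\<close> start at 1. Being positive,
    they let \<open>P\<close> and the monomials vanish at 0; the exponent 1 belongs to
    \<open>j\<close>.\<close>
  define e where "e i = f i - 3" for i
  have ne: "a \<noteq> b" "a \<noteq> c" "a \<noteq> d" "b \<noteq> c" "b \<noteq> d" "c \<noteq> d" "a \<notin> I" "b \<notin> I" "c \<notin> I" "d \<notin> I" "j \<in> I"
    using fi by (auto simp: I_def)
  have UNIV: "UNIV = insert a (insert b (insert c (insert d I)))"
  proof -
    have "i = a \<or> i = b \<or> i = c \<or> i = d" if "f i \<le> 3" for i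
    proof -
      have "f i = 0 \<or> f i = 1 \<or> f i = 2 \<or> f i = 3" using that by linarith
      then show ?thesis using fi inj by (metis injD)
    qed
    then show ?thesis by (force simp: I_def not_less)
  qed
  have e: "e i > 0" if "i \<in> I" for i
    using that by (simp add: e_def I_def)
  have e_inj: "e i = e k \<longleftrightarrow> i = k" if "i \<in> I" "k \<in> I" for i k
  proof
    assume "e i = e k"
    then have "f i = f k"
      using that by (simp add: e_def I_def)
    then show "i = k"
      using inj by (simp add: injD)
  qed simp
  have ej: "e j = 1"
    by (simp add: e_def fi)
  define P where "P = (\<Sum>i\<in>I. monom (1::complex) (2 * e i))"
  have P: "poly P w = (\<Sum>i\<in>I. (w ^ e i)\<^sup>2)" for w
    by (simp add: P_def poly_sum poly_monom power_mult[symmetric] mult.commute)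
  define \<xi> where "\<xi> i = (if i = a \<or> i = b then 0 else if i = c then 1 - P
      else if i = d then smult \<i> (1 + P) else monom 2 (e i))" for i
  have \<xi>_I: "poly (\<xi> i) w = 2 * w ^ e i" if "i \<in> I" for i w
    using that ne by (auto simp: \<xi>_def poly_monom)
  have sum_UNIV: "(\<Sum>i\<in>UNIV. h i) = h a + h b + h c + h d + (\<Sum>i\<in>I. h i)"
    for h :: "'n \<Rightarrow> complex"
    unfolding UNIV using ne by (simp add: add.assoc)
  have product: "(\<Sum>i\<in>UNIV. poly (\<xi> i) v * poly (\<xi> i) w) = - 2 * (\<Sum>i\<in>I. (v ^ e i - w ^ e i)\<^sup>2)"
    for v w
  proof -
    have "(\<Sum>i\<in>UNIV. poly (\<xi> i) v * poly (\<xi> i) w) =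
        - 2 * poly P v - 2 * poly P w + (\<Sum>i\<in>I. 4 * (v ^ e i * w ^ e i))"
      unfolding sum_UNIV using ne by (simp add: \<xi>_I) (simp add: \<xi>_def algebra_simps)
    also have "\<dots> = - 2 * (\<Sum>i\<in>I. (v ^ e i - w ^ e i)\<^sup>2)"
      unfolding P sum_distrib_left sum_subtractf[symmetric] sum.distrib[symmetric]
      by (rule sum.cong) (simp_all add: power2_eq_square algebra_simps)
    finally show ?thesis .
  qed
  interpret null_curve a b \<xi>
  proof
    show "(\<Sum>i\<in>UNIV. (poly (\<xi> i) w)\<^sup>2) = 0" for w
      using product[of w w] by (simp add: power2_eq_square)
    show "\<exists>i. poly (\<xi> i) w \<noteq> 0" for w
    proof (rule ccontr)
      assume "\<nexists>i. poly (\<xi> i) w \<noteq> 0"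
      then have "poly (\<xi> c) w = 0" "poly (\<xi> d) w = 0" by auto
      then have "1 - poly P w = 0" "1 + poly P w = 0"
        using ne by (simp_all add: \<xi>_def split: if_splits)
      then show False by (simp add: complex_eq_iff)
    qed
  qed (use ne in \<open>auto simp: \<xi>_def\<close>)
  have "full_foliation fibres"
  proof (rule full_null_curve)
    show "poly (\<xi> j) w = 0 \<longleftrightarrow> w = 0" for w
      by (simp add: \<xi>_I ne ej)
    fix t :: "'n \<Rightarrow> real" and k
    assume t: "\<And>w. (\<Sum>i\<in>UNIV. t i *\<^sub>R poly (\<xi> i) w) = 0" and k: "k \<noteq> a" "k \<noteq> b"
    \<comment> \<open>At 0 only the components \<open>c\<close> and \<open>d\<close> survive, with
      the values 1 and \<i>, so the real coefficients \<open>t c\<close> and \<open>t d\<close>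
      vanish. The other coefficients are then read off from monomials of distinct degrees.\<close>
    have "poly P 0 = 0"
      unfolding P by (rule sum.neutral) (auto dest: e)
    moreover have "(\<Sum>i\<in>I. t i *\<^sub>R poly (\<xi> i) 0) = 0"
      by (rule sum.neutral) (auto simp: \<xi>_I dest: e)
    ultimately have "t c + t d *\<^sub>R \<i> = 0"
      using t[of 0] ne unfolding sum_UNIV by (simp add: \<xi>_def scaleR_conv_of_real)
    then have cd: "t c = 0" "t d = 0"
      by (simp_all add: complex_eq_iff)
    have "poly (\<Sum>i\<in>I. monom (complex_of_real (t i)) (e i)) w = 0" for w
    proof -
      have "(\<Sum>i\<in>I. 2 * (of_real (t i) * w ^ e i)) = 0"
        using t[of w] unfolding sum_UNIV by (simp add: \<xi>_I cd \<xi>_ab scaleR_conv_of_real mult_ac)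
      then show ?thesis
        by (simp add: poly_sum poly_monom sum_distrib_left[symmetric])
    qed
    then have zero: "(\<Sum>i\<in>I. monom (complex_of_real (t i)) (e i)) = 0"
      using poly_all_0_iff_0 by blast
    have "t k = 0" if k: "k \<in> I"
    proof -
      have "0 = coeff (\<Sum>i\<in>I. monom (complex_of_real (t i)) (e i)) (e k)"
        by (simp add: zero)
      also have "\<dots> = (\<Sum>i\<in>I. if i = k then of_real (t i) else 0)"
        unfolding coeff_sum by (rule sum.cong) (auto simp: e_inj k)
      also have "\<dots> = of_real (t k)"
        using k by simp
      finally show ?thesis by simp
    qed
    then show "t k = 0"
      using cd k UNIV by blast
  qed
  moreover have "\<not> foliation_from_kaehler fibres"
  proof -
    \<comment> \<open>At \<open>axis a r\<close> the coordinate \<zeta> has the real value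
      \<open>r\<close>, so the product formula is -2 times a sum of real squares, in which
      \<open>j\<close> contributes (r - s)^2 > 0.\<close>
    have "(\<Sum>x\<in>Basis. D (axis a r) x * D (axis a s) x) \<noteq> 0" if "r \<noteq> s" for r s
    proof -
      have "(\<Sum>i\<in>I. (r ^ e i - s ^ e i)\<^sup>2) > 0"
        using that ne ej by (intro sum_pos2[where i = j]) auto
      then have "- 2 * (\<Sum>i\<in>I. (r ^ e i - s ^ e i)\<^sup>2) \<noteq> 0"
        by linarith
      moreover have "(\<Sum>x\<in>Basis. D (axis a r) x * D (axis a s) x) =
          of_real (- 2 * (\<Sum>i\<in>I. (r ^ e i - s ^ e i)\<^sup>2))"
        unfolding D_def gradient_product by (simp add: product \<zeta>_axis)
      ultimately show ?thesis
        by (simp only: of_real_eq_0_iff not_False_eq_True)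
    qed
    then show ?thesis
      using not_from_kaehler_fibres[of "axis a 0" "axis a 1" "axis a 2"] by simp
  qed
  moreover have "\<forall>L\<in>fibres. minimal_submanifold L"
    using minimal_fibre by (auto simp: fibres_def)
  ultimately show ?thesis
    using foliation_fibres conformal_fibres by blast
qed

end
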